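(* There exist sequences $\{\mathcal{A}_k\}_{k=1}^\infty$ of labyrinth patterns, each of which is horizontally blocked and not vertically blocked, such that the resulting mixed labyrinth fractal $L_\infty$ has the following properties: 1. The arc in $L_\infty$ that connects the top and the bottom exit of $L_\infty$ has finite length (equal to $1$). For every $n\ge 1$ and every square $W\in\mathcal{W}_n$, the arc in $L_\infty$ that connects the top and bottom exit of $W$ is a vertical segment with finite length. Any vertical line segment that is contained in $L_\infty$ has finite length. 2. The arc in $L_\infty$ that connects the left and the right exit of $L_\infty$ has infinite length. For every $n\ge1$ and every square $W\in\mathcal{W}_n$, the arc in $L_\infty$ that connects the left and right exit of $W$ has infinite length. 3. If $e_1$ is either the top or the bottom exit of $L_\infty$ and $e_2$ is either the left or the right exit of $L_\infty$, then the arc in $L_\infty$ that connects $e_1$ and $e_2$ has infinite length; and the same holds for the arcs between these pairs of exits of any square $W\in\mathcal{W}_n$, $n\ge1$.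
   Context: For an integer $m\ge 1$ let $S_{i,j,m}=\{(x,y)\mid \frac{i}{m}\le x\le\frac{i+1}{m},\ \frac{j}{m}\le y\le \frac{j+1}{m}\}$ and $\mathcal{S}_m=\{S_{i,j,m}\mid 0\le i\le m-1,\ 0\le j\le m-1\}$. A nonempty $\mathcal{A}\subseteq\mathcal{S}_m$ is called an $m$-pattern and $m$ its width; the elements of $\mathcal{A}$ are its white squares and those of $\mathcal{S}_m\setminus\mathcal{A}$ its black squares. For a square $Q=[x,x+q]\times[y,y+q]\subseteq[0,1]^2$ let $P_Q(z_x,z_y)=(qz_x+x,\,qz_y+y)$. Given a sequence of patterns $\mathcal{A}_k\subseteq\mathcal{S}_{m_k}$, $k\ge1$, put $m(n)=\prod_{k=1}^n m_k$, $\mathcal{W}_1=\mathcal{A}_1$ and, for $n\ge2$, $\mathcal{W}_n=\{P_{W'}(W)\mid W\in\mathcal{A}_n,\ W'\in\mathcal{W}_{n-1}\}\subset\mathcal{S}_{m(n)}$ (the white squares of level $n$). Let $L_n=\bigcup_{W\in\mathcal{W}_n}W$. The limit set defined by the sequence is $L_\infty=\bigcap_{n\ge1}L_n$. The graph $\mathcal{G}(\mathcal{A})$ of an $m$-pattern $\mathcal{A}$ has the white squares as vertices, and its edges are the unordered pairs of white squares having a common side. The top row of $\mathcal{A}$ is the set of white squares in $\{S_{i,m-1,m}\mid 0\le i\le m-1\}$; bottom row, left column and right column are defined analogously. A top exit in $\mathcal{A}$ is a white square in the top row such that there is a white square in the same column in the bottom row; a bottom exit is defined analogously. A left exit is a white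 square in the left column such that there is a white square in the same row in the right column; a right exit is defined analogously. An $m$-pattern $\mathcal{A}$ with $m\ge3$ is a labyrinth pattern if: (1) $\mathcal{G}(\mathcal{A})$ is a tree; (2) there is exactly one top exit, exactly one bottom exit, exactly one left exit and exactly one right exit in $\mathcal{A}$; (3) if there is a white square at a corner of $\mathcal{A}$, then there is no white square at the diagonally opposite corner. If all $\mathcal{A}_k$ are labyrinth patterns, then each $\mathcal{W}_n$, regarded as an $m(n)$-pattern, also satisfies (1), (2), (3) (known), and $L_\infty$ is called a mixed labyrinth fractal; it is known to be a dendrite, so any two distinct points of $L_\infty$ are connected by a unique arc in $L_\infty$. Exits of $L_\infty$: if $T_n\in\mathcal{W}_n$ is the top exit of $\mathcal{W}_n$, the top exit of $L_\infty$ is the point $\bigcap_{n\ge1}T_n$; the bottom, left and right exits of $L_\infty$ are defined analogously. Exits of a square $W\in\mathcal{W}_n$: the top exit of $W$ is the point of intersection of $L_\infty$ with the top edge of $W$; the bottom, left and right exits of $W$ are defined analogously. A labyrinth pattern is horizontally blocked if the row of squares from the left to the right exit contains at least one black square, and vertically blocked if the column of squares from the top to the bottom exit contains at least one black square. *)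

theory Defs
  imports "HOL-Analysis.Analysis"
begin

type_synonym point = "real \<times> real"

text \<open>Squares are closed sets of points of the plane, with the Euclidean metric of \<^typ>\<open>real \<times> real\<close>.\<close>

definition square :: "real \<Rightarrow> real \<Rightarrow> real \<Rightarrow> point set" where
  "square x y q = {x..x + q} \<times> {y..y + q}"

definition grid_square :: "nat \<Rightarrow> nat \<Rightarrow> nat \<Rightarrow> point set" where
  "grid_square i j m =
    {(x, y). real i / real m \<le> x \<and> x \<le> (real i + 1) / real m \<and>
             real j / real m \<le> y \<and> y \<le> (real j + 1) / real m}"

definition grid :: "nat \<Rightarrow> point set set" where
  "grid m = {grid_square i j m | i j. i < m \<and> j < m}"

definition pattern :: "nat \<Rightarrow> point set set \<Rightarrow> bool" where
  "pattern m A \<longleftrightarrow> m \<ge> 1 \<and> A \<noteq> {} \<and> A \<subseteq> grid m"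

text \<open>The map of the unit square onto \<^term>\<open>square x y q\<close>.\<close>

definition place :: "real \<Rightarrow> real \<Rightarrow> real \<Rightarrow> point \<Rightarrow> point" where
  "place x y q z = (q * fst z + x, q * snd z + y)"

text \<open>Sequences are indexed from 1; the values at index 0 are never used.\<close>

fun white_squares :: "(nat \<Rightarrow> point set set) \<Rightarrow> nat \<Rightarrow> point set set" where
  "white_squares A 0 = {}"
| "white_squares A (Suc 0) = A 1"
| "white_squares A (Suc (Suc n)) =
    {place x y q ` W | x y q W.
       q > 0 \<and> W \<in> A (Suc (Suc n)) \<and> square x y q \<in> white_squares A (Suc n)}"

definition level_width :: "(nat \<Rightarrow> nat) \<Rightarrow> nat \<Rightarrow> nat" where
  "level_width m n = (\<Prod>k=1..n. m k)"

definition limit_set :: "(nat \<Rightarrow> point set set) \<Rightarrow> point set" where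
  "limit_set A = (\<Inter>n\<in>{1..}. \<Union>(white_squares A n))"

datatype side = Top | Bottom | Left | Right

primrec edge :: "side \<Rightarrow> point set \<Rightarrow> point set" where
  "edge Top S = {p \<in> S. \<forall>r\<in>S. snd r \<le> snd p}"
| "edge Bottom S = {p \<in> S. \<forall>r\<in>S. snd p \<le> snd r}"
| "edge Left S = {p \<in> S. \<forall>r\<in>S. fst p \<le> fst r}"
| "edge Right S = {p \<in> S. \<forall>r\<in>S. fst r \<le> fst p}"

definition common_side :: "point set \<Rightarrow> point set \<Rightarrow> bool" where
  "common_side S T \<longleftrightarrow> (\<exists>d e. edge d S = edge e T)"

definition pattern_graph :: "point set set \<Rightarrow> point set set set" where
  "pattern_graph A = {{S, T} | S T. S \<in> A \<and> T \<in> A \<and> S \<noteq> T \<and> common_side S T}"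

text \<open>A tree with vertex set \<open>V\<close> and set \<open>E\<close> of unordered edges: nonempty, connected, and
  without cycles (of length at least 3, as the graph is simple).\<close>

definition tree_graph :: "'v set \<Rightarrow> 'v set set \<Rightarrow> bool" where
  "tree_graph V E \<longleftrightarrow>
    V \<noteq> {} \<and>
    (\<forall>u\<in>V. \<forall>v\<in>V. (u, v) \<in> {(x, y). {x, y} \<in> E}\<^sup>*) \<and>
    \<not> (\<exists>c. length c \<ge> 3 \<and> distinct c \<and> set c \<subseteq> V \<and>
           successively (\<lambda>x y. {x, y} \<in> E) c \<and> {last c, hd c} \<in> E)"

primrec is_exit :: "side \<Rightarrow> nat \<Rightarrow> point set set \<Rightarrow> point set \<Rightarrow> bool" where
  "is_exit Top m A S \<longleftrightarrow>
    (\<exists>i<m. S = grid_square i (m - 1) m \<and> S \<in> A \<and> grid_square i 0 m \<in> A)"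
| "is_exit Bottom m A S \<longleftrightarrow>
    (\<exists>i<m. S = grid_square i 0 m \<and> S \<in> A \<and> grid_square i (m - 1) m \<in> A)"
| "is_exit Left m A S \<longleftrightarrow>
    (\<exists>j<m. S = grid_square 0 j m \<and> S \<in> A \<and> grid_square (m - 1) j m \<in> A)"
| "is_exit Right m A S \<longleftrightarrow>
    (\<exists>j<m. S = grid_square (m - 1) j m \<and> S \<in> A \<and> grid_square 0 j m \<in> A)"

definition labyrinth_pattern :: "nat \<Rightarrow> point set set \<Rightarrow> bool" where
  "labyrinth_pattern m A \<longleftrightarrow>
    m \<ge> 3 \<and> pattern m A \<and>
    tree_graph A (pattern_graph A) \<and>
    (\<forall>d. \<exists>!S. is_exit d m A S) \<and>
    \<not> (grid_square 0 0 m \<in> A \<and> grid_square (m - 1) (m - 1) m \<in> A) \<and>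
    \<not> (grid_square 0 (m - 1) m \<in> A \<and> grid_square (m - 1) 0 m \<in> A)"

definition horizontally_blocked :: "nat \<Rightarrow> point set set \<Rightarrow> bool" where
  "horizontally_blocked m A \<longleftrightarrow>
    (\<exists>j<m. is_exit Left m A (grid_square 0 j m) \<and> is_exit Right m A (grid_square (m - 1) j m) \<and>
           (\<exists>i<m. grid_square i j m \<notin> A))"

definition vertically_blocked :: "nat \<Rightarrow> point set set \<Rightarrow> bool" where
  "vertically_blocked m A \<longleftrightarrow>
    (\<exists>i<m. is_exit Bottom m A (grid_square i 0 m) \<and> is_exit Top m A (grid_square i (m - 1) m) \<and>
           (\<exists>j<m. grid_square i j m \<notin> A))"

text \<open>\<open>p\<close> is the exit of the limit set on side \<open>d\<close>. The definite description is proper because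
  the white squares of each level of a sequence of labyrinth patterns satisfy the conditions
  on exits again.\<close>

definition limit_exit ::
  "(nat \<Rightarrow> nat) \<Rightarrow> (nat \<Rightarrow> point set set) \<Rightarrow> side \<Rightarrow> point \<Rightarrow> bool" where
  "limit_exit m A d p \<longleftrightarrow>
    (\<Inter>n\<in>{1..}. THE T. is_exit d (level_width m n) (white_squares A n) T) = {p}"

text \<open>\<open>p\<close> is the exit of the square \<open>W\<close> on side \<open>d\<close>; the intersection has to be a single point.\<close>

definition square_exit :: "(nat \<Rightarrow> point set set) \<Rightarrow> point set \<Rightarrow> side \<Rightarrow> point \<Rightarrow> bool" where
  "square_exit A W d p \<longleftrightarrow> limit_set A \<inter> edge d W = {p}"

definition arc_from_to :: "point set \<Rightarrow> point \<Rightarrow> point \<Rightarrow> point set \<Rightarrow> bool" where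
  "arc_from_to X a b C \<longleftrightarrow>
    C \<subseteq> X \<and> (\<exists>g. arc g \<and> path_image g = C \<and> pathstart g = a \<and> pathfinish g = b)"

text \<open>\<open>C\<close> is the one and only arc in \<open>X\<close> that connects \<open>a\<close> and \<open>b\<close>.\<close>

definition the_arc :: "point set \<Rightarrow> point \<Rightarrow> point \<Rightarrow> point set \<Rightarrow> bool" where
  "the_arc X a b C \<longleftrightarrow> {D. arc_from_to X a b D} = {C}"

text \<open>The length of a curve on \<open>{0..1}\<close>, as the supremum of the lengths of inscribed polygonal
  chains. The vertices of a chain have parameters \<open>t 0 \<le> \<dots> \<le> t n\<close>.\<close>

definition curve_length :: "(real \<Rightarrow> 'a::metric_space) \<Rightarrow> ennreal" where
  "curve_length g =
    (SUP (n, t) \<in> {(n::nat, t::nat \<Rightarrow> real). t ` {..n} \<subseteq> {0..1} \<and> mono_on {..n} t}.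
       \<Sum>i<n. ennreal (dist (g (t i)) (g (t (Suc i)))))"

text \<open>The length of an arc, given as a set of points. It does not depend on the chosen
  parametrization, as any two parametrizations of an arc by homeomorphisms differ by a monotone
  change of parameter.\<close>

definition arc_length :: "'a::metric_space set \<Rightarrow> ennreal" where
  "arc_length C = curve_length (SOME g. arc g \<and> path_image g = C)"

end

theory Submission
  imports Defs
begin

text \<open>
  One pattern, repeated at every level, suffices. It has width 5; its white squares are the full
  column 3, a left arm (0,2), (1,2), (1,3), (2,3) that reaches the column at height 3, and a right
  arm consisting of (4,2) alone. The left and right exits lie in row 2, where (2,2) is black. The
  limit set X is then the attractor of the ten maps z \<mapsto> (z + w) / 5, where w runs through the
  white positions, and it contains the vertical segment over 3/4 that joins its top to its bottom
  exit.

  \<^emph>\<open>Cut points.\<close> X meets the boundary of the unit square only in its four exits (lemmas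
  \<open>fractal_left\<close>, \<open>fractal_right\<close>, \<open>fractal_bottom\<close>, \<open>fractal_top\<close>). Therefore two of the ten
  copies of X meet only if their squares have a common side, and then in a single point
  (\<open>copies_meet\<close>). As the squares form a tree, these points are cut points of X.

  \<^emph>\<open>Uniqueness of arcs.\<close> A connected subset of X without cut points of its own lies on one side of
  each of these points, hence in one of the ten copies. Magnified by 5, it is again such a subset
  of X; so its diameter is 0. Thus X contains no simple closed curve
  (\<open>fractal_no_simple_closed_curve\<close>), and arcs in X are determined by their endpoints
  (\<open>the_arcI\<close>).

  \<^emph>\<open>Existence of arcs.\<close> The path from the left exit to the column, and the one from the right exit,
  consist of vertical segments and of copies, shrunk by 5, of these two paths. They are uniform
  limits of the iterates of this substitution (\<open>arms_limit\<close>).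

  \<^emph>\<open>Lengths.\<close> Let LR be the infimum of the lengths of the arcs in X from the left to the right
  exit, and LT, LB, TR, BR likewise. Cutting an arc at the cut points gives five inequalities:
  5 LR \<ge> 3 LR + LT + BR + LB + TR, and similar ones for the other four. Multiplied by 12, 5, 3, 3, 5
  (for LR, LT, LB, TR, BR) and added, they lose all their variables. But the arc from the bottom to
  the right exit first climbs two squares of the column, which contributes a positive constant to its
  lower bound; so these numbers cannot all be finite
  (\<open>exit_distance_Left_Right_infinite\<close>). The other arcs to the left or to the right exit contain a
  small copy of the arc from left to right, so that they are of infinite length, too.

  All statements about a square of level n follow by similarity, as the part of X in the interior
  of the square is a copy of the part of X in the interior of the unit square.
\<close>

section \<open>Length of curves\<close>

lemma curve_length_chain_le:
  assumes "t ` {..n::nat} \<subseteq> {0..1::real}" "mono_on {..n} t"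
  shows "(\<Sum>i<n. ennreal (dist (g (t i)) (g (t (Suc i))))) \<le> curve_length g"
  unfolding curve_length_def by (rule SUP_upper2[where i = "(n, t)"]) (use assms in auto)

lemma curve_length_leI:
  assumes "\<And>n t. t ` {..n::nat} \<subseteq> {0..1::real} \<Longrightarrow> mono_on {..n} t \<Longrightarrow>
             (\<Sum>i<n. ennreal (dist (g (t i)) (g (t (Suc i))))) \<le> L"
  shows "curve_length g \<le> L"
  unfolding curve_length_def using assms by (intro SUP_least) auto

lemma dist_le_curve_length: "ennreal (dist (g 0) (g 1)) \<le> curve_length g"
proof -
  have "real ` {..1} \<subseteq> {0..1}" by auto
  then show ?thesis using curve_length_chain_le[of real 1 g] by (auto simp: mono_on_def)
qed

lemma curve_length_linepath:
  fixes a b :: "'a::real_normed_vector"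
  shows "curve_length (linepath a b) = dist a b"
proof (rule antisym)
  show "curve_length (linepath a b) \<le> ennreal (dist a b)"
  proof (rule curve_length_leI)
    fix n :: nat and t :: "nat \<Rightarrow> real"
    assume t: "t ` {..n} \<subseteq> {0..1}" "mono_on {..n} t"
    have "(\<Sum>i<n. ennreal (dist (linepath a b (t i)) (linepath a b (t (Suc i)))))
        = (\<Sum>i<n. ennreal ((t (Suc i) - t i) * dist a b))"
    proof (rule sum.cong)
      fix i assume "i \<in> {..<n}"
      then have le: "t i \<le> t (Suc i)" using t(2) by (auto simp: mono_on_def)
      have "linepath a b (t i) - linepath a b (t (Suc i)) = (t (Suc i) - t i) *\<^sub>R (a - b)"
        by (simp add: linepath_def algebra_simps)
      then show "ennreal (dist (linepath a b (t i)) (linepath a b (t (Suc i)))) =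
          ennreal ((t (Suc i) - t i) * dist a b)"
        using le by (simp add: dist_norm)
    qed simp
    also have "\<dots> = ennreal (\<Sum>i<n. (t (Suc i) - t i) * dist a b)"
      using t(2) by (intro sum_ennreal) (auto simp: mono_on_def)
    also have "(\<Sum>i<n. (t (Suc i) - t i) * dist a b) = (t n - t 0) * dist a b"
      by (simp flip: sum_distrib_right add: sum_lessThan_telescope)
    also have "\<dots> \<le> 1 * dist a b"
    proof (intro mult_right_mono)
      have "t n \<in> {0..1}" "t 0 \<in> {0..1}" using t(1) by auto
      then show "t n - t 0 \<le> 1" by auto
    qed simp
    finally show "(\<Sum>i<n. ennreal (dist (linepath a b (t i)) (linepath a b (t (Suc i)))))
        \<le> ennreal (dist a b)"
      by (simp add: ennreal_leI)
  qed
  show "ennreal (dist a b) \<le> curve_length (linepath a b)"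
    using dist_le_curve_length[of "linepath a b"] by (simp add: linepath_def)
qed

lemma curve_length_scale:
  assumes c: "c \<ge> 0" and f: "\<And>x y. dist (f x) (f y) = c * dist x y"
  shows "curve_length (f \<circ> g) = ennreal c * curve_length g"
proof -
  have "ennreal (dist ((f \<circ> g) x) ((f \<circ> g) y)) = ennreal c * ennreal (dist (g x) (g y))" for x y
    using c by (simp add: f ennreal_mult)
  then show ?thesis
    unfolding curve_length_def SUP_mult_left_ennreal sum_distrib_left case_prod_unfold by simp
qed

lemma curve_length_reparam_le:
  assumes im: "\<phi> ` {0..1} \<subseteq> {0..1::real}"
    and mono: "mono_on {0..1} \<phi> \<or> antimono_on {0..1} \<phi>"
  shows "curve_length (g \<circ> \<phi>) \<le> curve_length g"
proof (rule curve_length_leI)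
  fix n :: nat and t :: "nat \<Rightarrow> real"
  assume t: "t ` {..n} \<subseteq> {0..1}" "mono_on {..n} t"
  have t1: "t i \<in> {0..1}" if "i \<le> n" for i using t(1) that by auto
  have im': "\<phi> (t i) \<in> {0..1}" if "i \<le> n" for i
    using im imageI[OF t1[OF that], of \<phi>] by (rule subsetD)
  show "(\<Sum>i<n. ennreal (dist ((g \<circ> \<phi>) (t i)) ((g \<circ> \<phi>) (t (Suc i))))) \<le> curve_length g"
    using mono
  proof
    assume "mono_on {0..1} \<phi>"
    then have "mono_on {..n} (\<phi> \<circ> t)"
      using t t1 by (auto simp: mono_on_def)
    moreover have "(\<phi> \<circ> t) ` {..n} \<subseteq> {0..1}"
      by (rule image_subsetI) (simp only: comp_apply atMost_iff im')
    ultimately show ?thesis using curve_length_chain_le[of "\<phi> \<circ> t" n g] by simp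
  next
    \<comment> \<open>A chain run through backwards is a chain again.\<close>
    assume anti: "antimono_on {0..1} \<phi>"
    define s where "s i = \<phi> (t (n - i))" for i
    have "mono_on {..n} s"
    proof (rule mono_onI)
      fix i j :: nat
      assume "i \<in> {..n}" "j \<in> {..n}" "i \<le> j"
      then have "t (n - j) \<le> t (n - i)" by (intro mono_onD[OF t(2)]) auto
      then show "s i \<le> s j"
        unfolding s_def by (intro monotone_onD[OF anti] t1) auto
    qed
    moreover have "s ` {..n} \<subseteq> {0..1}"
      by (rule image_subsetI) (simp only: s_def im' diff_le_self)
    ultimately have "(\<Sum>i<n. ennreal (dist (g (s i)) (g (s (Suc i))))) \<le> curve_length g"
      by (intro curve_length_chain_le)
    also have "(\<Sum>i<n. ennreal (dist (g (s i)) (g (s (Suc i))))) =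
        (\<Sum>i<n. ennreal (dist (g (s (n - Suc i))) (g (s (Suc (n - Suc i))))))"
      by (rule sum.nat_diff_reindex[symmetric])
    also have "\<dots> = (\<Sum>i<n. ennreal (dist ((g \<circ> \<phi>) (t i)) ((g \<circ> \<phi>) (t (Suc i)))))"
      by (intro sum.cong) (auto simp: s_def dist_commute Suc_diff_Suc)
    finally show ?thesis .
  qed
qed

text \<open>
  Two arcs with the same image differ by a continuous injective change of parameter, and such a map
  of an interval is monotone. A decreasing one only reverses the chains.
\<close>

lemma curve_length_arc_le:
  fixes g h :: "real \<Rightarrow> 'a::metric_space"
  assumes g: "arc g" and h: "arc h" and eq: "path_image g = path_image h"
  shows "curve_length h \<le> curve_length g"
proof -
  obtain k where k: "homeomorphism {0..1} (path_image g) g k"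
    using homeomorphism_arc[OF g] by blast
  define \<phi> where "\<phi> = k \<circ> h"
  have cont: "continuous_on {0..1} \<phi>"
    unfolding \<phi>_def
    by (metis (no_types) arc_imp_path eq h homeomorphism_cont2 k path_def path_image_def
        continuous_on_compose)
  have im: "\<phi> ` {0..1} \<subseteq> {0..1}"
    using k eq unfolding \<phi>_def image_comp[symmetric] homeomorphism_def path_image_def by auto
  have hg: "h x = (g \<circ> \<phi>) x" if "x \<in> {0..1}" for x
  proof -
    have "h x \<in> path_image g" using that eq by (auto simp: path_image_def)
    then show ?thesis using k by (auto simp: homeomorphism_def \<phi>_def)
  qed
  have "inj_on \<phi> {0..1}"
    using h hg unfolding arc_def inj_on_def by (metis comp_apply)
  then have "strict_mono_on {0..1} \<phi> \<or> strict_antimono_on {0..1} \<phi>"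
    using injective_eq_monotone_map[of "{0..1}" \<phi>] cont is_interval_cc by blast
  then have "mono_on {0..1} \<phi> \<or> antimono_on {0..1} \<phi>"
    using strict_mono_iff_mono strict_antimono_iff_antimono by blast
  then have "curve_length (g \<circ> \<phi>) \<le> curve_length g"
    using im by (intro curve_length_reparam_le)
  moreover have "curve_length h \<le> curve_length (g \<circ> \<phi>)"
  proof (rule curve_length_leI)
    fix n :: nat and t :: "nat \<Rightarrow> real"
    assume t: "t ` {..n} \<subseteq> {0..1}" "mono_on {..n} t"
    have "(\<Sum>i<n. ennreal (dist (h (t i)) (h (t (Suc i))))) =
        (\<Sum>i<n. ennreal (dist ((g \<circ> \<phi>) (t i)) ((g \<circ> \<phi>) (t (Suc i)))))"
    proof (rule sum.cong)
      fix i assume "i \<in> {..<n}"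
      then have "i \<in> {..n}" "Suc i \<in> {..n}" by auto
      then have "t i \<in> {0..1}" "t (Suc i) \<in> {0..1}" using t(1) by blast+
      then show "ennreal (dist (h (t i)) (h (t (Suc i)))) =
          ennreal (dist ((g \<circ> \<phi>) (t i)) ((g \<circ> \<phi>) (t (Suc i))))"
        by (simp add: hg)
    qed simp
    also have "\<dots> \<le> curve_length (g \<circ> \<phi>)" by (rule curve_length_chain_le[OF t])
    finally show "(\<Sum>i<n. ennreal (dist (h (t i)) (h (t (Suc i))))) \<le> curve_length (g \<circ> \<phi>)" .
  qed
  ultimately show ?thesis by simp
qed

text \<open>
  This removes the choice in the definition of \<^const>\<open>arc_length\<close>.
\<close>

lemma arc_length_path_image:
  assumes "arc g"
  shows "arc_length (path_image g) = curve_length g"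
proof -
  define h where "h = (SOME h. arc h \<and> path_image h = path_image g)"
  have "arc h \<and> path_image h = path_image g"
    unfolding h_def using someI[of "\<lambda>h. arc h \<and> path_image h = path_image g" g] assms by simp
  then have "curve_length h = curve_length g"
    using assms curve_length_arc_le by (metis order_antisym)
  then show ?thesis by (simp add: arc_length_def h_def)
qed

text \<open>
  A chain of the first part followed by a chain of the second part is a chain of the whole curve.
\<close>

lemma curve_length_subpaths:
  assumes s: "s \<in> {0..1}"
  shows "curve_length (subpath 0 s g) + curve_length (subpath s 1 g) \<le> curve_length g"
proof -
  have two: "(\<Sum>i<n. ennreal (dist (subpath 0 s g (t i)) (subpath 0 s g (t (Suc i)))))
      + (\<Sum>i<n'. ennreal (dist (subpath s 1 g (t' i)) (subpath s 1 g (t' (Suc i)))))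
      \<le> curve_length g"
    if t: "t ` {..n} \<subseteq> {0..1}" "mono_on {..n} t"
      and t': "t' ` {..n'} \<subseteq> {0..1}" "mono_on {..n'} t'" for n n' :: nat and t t'
  proof -
    have t1: "0 \<le> t i \<and> t i \<le> 1" if "i \<le> n" for i using t(1) that by force
    have t1': "0 \<le> t' i \<and> t' i \<le> 1" if "i \<le> n'" for i using t'(1) that by force
    define a where "a i = s * t i" for i
    define b where "b i = s + (1 - s) * t' i" for i
    define r where "r i = (if i \<le> n then a i else b (i - Suc n))" for i
    have as: "0 \<le> a i \<and> a i \<le> s" if "i \<le> n" for i
      using t1[OF that] s unfolding a_def by (auto simp: mult_left_le)
    have bs: "s \<le> b i \<and> b i \<le> 1" if "i \<le> n'" for i
      using t1'[OF that] s mult_left_le[of "t' i" "1 - s"] unfolding b_def by auto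
    have am: "a i \<le> a j" if "i \<le> j" "j \<le> n" for i j
      unfolding a_def using that s by (intro mult_left_mono mono_onD[OF t(2)]) auto
    have bm: "b i \<le> b j" if "i \<le> j" "j \<le> n'" for i j
      unfolding b_def using that s by (intro add_left_mono mult_left_mono mono_onD[OF t'(2)]) auto
    have ran: "r ` {..Suc (n + n')} \<subseteq> {0..1}"
    proof
      fix y assume "y \<in> r ` {..Suc (n + n')}"
      then obtain i where i: "i \<le> Suc (n + n')" "y = r i" by auto
      then have "i \<le> n \<or> i - Suc n \<le> n'" by auto
      then show "y \<in> {0..1}"
        using as[of i] bs[of "i - Suc n"] s i by (fastforce simp: r_def)
    qed
    have mono: "mono_on {..Suc (n + n')} r"
    proof (rule mono_onI)
      fix i j assume ij: "i \<in> {..Suc (n + n')}" "j \<in> {..Suc (n + n')}" "i \<le> j"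
      consider "j \<le> n" | "i \<le> n" "n < j" | "n < i" using ij by linarith
      then show "r i \<le> r j"
      proof cases
        case 2
        then have "a i \<le> s" "s \<le> b (j - Suc n)" using as bs ij by auto
        then show ?thesis using 2 by (simp add: r_def)
      qed (use ij am bm in \<open>auto simp: r_def\<close>)
    qed
    let ?d = "\<lambda>i. ennreal (dist (g (r i)) (g (r (Suc i))))"
    have "(\<Sum>i<n. ennreal (dist (subpath 0 s g (t i)) (subpath 0 s g (t (Suc i))))) = sum ?d {..<n}"
      by (intro sum.cong) (auto simp: subpath_def r_def a_def)
    moreover have "(\<Sum>i<n'. ennreal (dist (subpath s 1 g (t' i)) (subpath s 1 g (t' (Suc i)))))
        = sum ?d {Suc n..<Suc n + n'}"
    proof -
      have "sum ?d {Suc n..<Suc n + n'} = (\<Sum>i = 0..<n'. ?d (i + Suc n))"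
        using sum.shift_bounds_nat_ivl[of ?d 0 "Suc n" n'] by (simp add: add.commute)
      also have "\<dots> = (\<Sum>i<n'. ennreal (dist (subpath s 1 g (t' i)) (subpath s 1 g (t' (Suc i)))))"
        by (intro sum.cong) (auto simp: subpath_def r_def b_def algebra_simps atLeast0LessThan)
      finally show ?thesis by simp
    qed
    moreover have "sum ?d {..<n} + sum ?d {Suc n..<Suc n + n'} = sum ?d ({..<n} \<union> {Suc n..<Suc n + n'})"
      by (intro sum.union_disjoint[symmetric]) auto
    moreover have "\<dots> \<le> sum ?d {..<Suc (n + n')}"
      by (intro sum_mono2) auto
    moreover have "\<dots> \<le> curve_length g" by (rule curve_length_chain_le[OF ran mono])
    ultimately show ?thesis by simp
  qed
  let ?C = "{(n::nat, t::nat \<Rightarrow> real). t ` {..n} \<subseteq> {0..1} \<and> mono_on {..n} t}"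
  have ne: "?C \<noteq> {}"
    by (auto intro!: exI[where x = "0::nat"] exI[where x = "\<lambda>_. 0"] simp: mono_on_def)
  have sup_add: "c + (SUP x\<in>?C. F x) \<le> L" if "\<And>x. x \<in> ?C \<Longrightarrow> c + F x \<le> L" for c L :: ennreal and F
    using that by (simp only: ennreal_SUP_add_right[OF ne]) (rule SUP_least)
  show ?thesis
    unfolding curve_length_def[of "subpath s 1 g"]
  proof (rule sup_add, safe)
    fix n' t' assume t': "t' ` {..n'} \<subseteq> {0..1}" "mono_on {..n'} (t' :: nat \<Rightarrow> real)"
    let ?s' = "\<Sum>i<n'. ennreal (dist (subpath s 1 g (t' i)) (subpath s 1 g (t' (Suc i))))"
    have "?s' + curve_length (subpath 0 s g) \<le> curve_length g"
      unfolding curve_length_def[of "subpath 0 s g"]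
    proof (rule sup_add, safe)
      fix n t assume "t ` {..n} \<subseteq> {0..1}" "mono_on {..n} (t :: nat \<Rightarrow> real)"
      from two[OF this t']
      show "?s' + (\<Sum>i<n. ennreal (dist (subpath 0 s g (t i)) (subpath 0 s g (t (Suc i))))) \<le> curve_length g"
        by (simp only: add.commute)
    qed
    then show "curve_length (subpath 0 s g) + ?s' \<le> curve_length g"
      by (simp only: add.commute)
  qed
qed

section \<open>Arcs in sets without simple closed curves\<close>

text \<open>
  When the parametrization starts at the removed point, what remains is the image of an open
  interval.
\<close>

lemma simple_closed_curve_no_cut_point:
  assumes "simple_path c" "pathfinish c = pathstart c"
  shows "connected (path_image c - {p})"
proof (cases "p \<in> path_image c")
  case True
  then obtain s where s: "s \<in> {0..1}" "p = c s" by (auto simp: path_image_def)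
  have "connected (path_image (shiftpath s c) - {pathstart (shiftpath s c), pathfinish (shiftpath s c)})"
    using s assms by (intro connected_simple_path_endless simple_path_shiftpath) auto
  then show ?thesis
    using s assms by (simp add: path_image_shiftpath pathstart_shiftpath pathfinish_shiftpath)
qed (use assms in \<open>simp add: connected_simple_path_image\<close>)

text \<open>
  Where \<open>g\<close> leaves the image of \<open>h\<close>, it does so on a maximal open interval \<open>(u, v)\<close> of parameters. The
  piece of \<open>g\<close> over \<open>[u, v]\<close> and the piece of \<open>h\<close> between the same two points close up to a simple
  closed curve.
\<close>

lemma arc_subset_arc_if_no_loop:
  fixes g h :: "real \<Rightarrow> 'a::real_normed_vector"
  assumes noloop: "\<And>c::real \<Rightarrow> 'a. simple_path c \<Longrightarrow> pathfinish c = pathstart c \<Longrightarrow> \<not> path_image c \<subseteq> X"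
    and g: "arc g" "path_image g \<subseteq> X" and h: "arc h" "path_image h \<subseteq> X"
    and ends: "pathstart g = pathstart h" "pathfinish g = pathfinish h"
  shows "path_image g \<subseteq> path_image h"
proof (rule ccontr)
  assume "\<not> path_image g \<subseteq> path_image h"
  then obtain t where t: "t \<in> {0..1}" "g t \<notin> path_image h"
    unfolding path_image_def[of g] by blast
  define S where "S = {s \<in> {0..1}. g s \<in> path_image h}"
  have "continuous_on {0..1} g" using g(1) by (simp add: arc_def path_def)
  moreover have "closed (path_image h)" using h(1) by (simp add: closed_arc_image)
  ultimately have "closed S"
    unfolding S_def using continuous_closed_preimage[of "{0..1}" g "path_image h"]
    by (simp add: vimage_def Int_def)
  then have cpt: "compact (S \<inter> {0..t})" "compact (S \<inter> {t..1})"
    by (auto intro: closed_Int_compact)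
  have S01: "0 \<in> S" "1 \<in> S"
    using ends pathstart_in_path_image[of h] pathfinish_in_path_image[of h]
    by (auto simp: S_def pathstart_def pathfinish_def)
  have "S \<inter> {0..t} \<noteq> {}" "S \<inter> {t..1} \<noteq> {}" using S01 t(1) by auto
  then obtain u v where u: "u \<in> S \<inter> {0..t}" "\<And>x. x \<in> S \<inter> {0..t} \<Longrightarrow> x \<le> u"
    and v: "v \<in> S \<inter> {t..1}" "\<And>x. x \<in> S \<inter> {t..1} \<Longrightarrow> v \<le> x"
    using compact_attains_sup[OF cpt(1)] compact_attains_inf[OF cpt(2)] by blast
  have "t \<notin> S" using t by (auto simp: S_def)
  then have utv: "u < t" "t < v" "u \<in> {0..1}" "v \<in> {0..1}"
    using u(1) v(1) by (auto simp: less_le S_def)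
  obtain p q where p: "p \<in> {0..1}" "h p = g u" and q: "q \<in> {0..1}" "h q = g v"
    using u(1) v(1) by (auto simp: S_def path_image_def)
  have "u \<noteq> v" using utv by simp
  then have "g u \<noteq> g v" using g(1) utv(3,4) by (auto simp: arc_def inj_on_def)
  then have pq: "q \<noteq> p" using p q by auto
  let ?g = "subpath u v g" and ?h = "subpath q p h"
  have arcs: "arc ?g" "arc ?h"
    using arc_subpath_arc[of g u v] arc_subpath_arc[of h q p] g(1) h(1) utv p q pq by auto
  have hsub: "path_image ?h \<subseteq> path_image h"
    by (rule path_image_subpath_subset) (use p q in auto)
  have gsub: "path_image ?g \<subseteq> path_image g"
    by (rule path_image_subpath_subset) (use utv in auto)
  have "path_image ?g \<inter> path_image ?h \<subseteq> {pathstart ?g, pathstart ?h}"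
  proof
    fix z assume z: "z \<in> path_image ?g \<inter> path_image ?h"
    then obtain s where s: "s \<in> {u..v}" "z = g s" using utv by (auto simp: path_image_subpath)
    then have "s \<in> S" using z hsub utv by (auto simp: S_def)
    then have "s = u \<or> s = v"
      using u(2)[of s] v(2)[of s] s(1) utv by (cases "s \<le> t") auto
    then show "z \<in> {pathstart ?g, pathstart ?h}" using s q by auto
  qed
  then have "simple_path (?g +++ ?h)"
    using arcs p q by (intro simple_path_join_loop) auto
  moreover have "pathfinish (?g +++ ?h) = pathstart (?g +++ ?h)" using p by simp
  moreover have "path_image (?g +++ ?h) \<subseteq> X"
    using path_image_join_subset[of ?g ?h] gsub hsub g(2) h(2) by blast
  ultimately show False using noloop by metis
qed

lemma arc_unique_if_no_loop:
  fixes g h :: "real \<Rightarrow> 'a::real_normed_vector"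
  assumes "\<And>c::real \<Rightarrow> 'a. simple_path c \<Longrightarrow> pathfinish c = pathstart c \<Longrightarrow> \<not> path_image c \<subseteq> X"
    and "arc g" "path_image g \<subseteq> X" and "arc h" "path_image h \<subseteq> X"
    and "pathstart g = pathstart h" "pathfinish g = pathfinish h"
  shows "path_image g = path_image h"
proof (rule antisym)
  show "path_image g \<subseteq> path_image h"
    by (rule arc_subset_arc_if_no_loop[OF assms])
  show "path_image h \<subseteq> path_image g"
    by (rule arc_subset_arc_if_no_loop[OF assms(1,4,5,2,3) assms(6,7)[symmetric]])
qed

lemma the_arcI:
  fixes X :: "point set"
  assumes noloop: "\<And>c::real \<Rightarrow> point. simple_path c \<Longrightarrow> pathfinish c = pathstart c \<Longrightarrow> \<not> path_image c \<subseteq> X"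
    and g: "arc g" "path_image g \<subseteq> X"
  shows "the_arc X (pathstart g) (pathfinish g) (path_image g)"
proof -
  have "D = path_image g" if D: "arc_from_to X (pathstart g) (pathfinish g) D" for D
  proof -
    obtain h where h: "D = path_image h" "arc h" "path_image h \<subseteq> X"
        "pathstart h = pathstart g" "pathfinish h = pathfinish g"
      using D unfolding arc_from_to_def by blast
    show ?thesis
      unfolding h(1) by (rule arc_unique_if_no_loop[of X, OF noloop h(2,3) g h(4,5)])
  qed
  moreover have "arc_from_to X (pathstart g) (pathfinish g) (path_image g)"
    using g by (auto simp: arc_from_to_def)
  ultimately show ?thesis unfolding the_arc_def by blast
qed

lemma connected_subset_of_two:
  fixes K :: "'a::t1_space set"
  assumes closed: "closed P" "closed Q" and PQ: "P \<inter> Q \<subseteq> {p}"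
    and K: "K \<subseteq> P \<union> Q" "connected K" "connected (K - {p})"
  shows "K \<subseteq> P \<or> K \<subseteq> Q"
proof -
  have *: "S \<subseteq> P \<or> S \<subseteq> Q" if "connected S" "S \<subseteq> P \<union> Q" "P \<inter> Q \<inter> S = {}" for S
    using that closed unfolding connected_closed by blast
  show ?thesis
  proof (cases "p \<in> P \<inter> Q")
    case True
    have "K - {p} \<subseteq> P \<or> K - {p} \<subseteq> Q" using PQ K by (intro *) auto
    then show ?thesis using True by auto
  next
    case False
    then show ?thesis using PQ K by (intro *) auto
  qed
qed

text \<open>
  The pieces form a tree from which they can be plucked leaf by leaf: each piece meets the union of
  the later ones in at most one point.
\<close>

primrec strippable :: "('b \<Rightarrow> 'a set) \<Rightarrow> 'b list \<Rightarrow> bool" where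
  "strippable F [] = True"
| "strippable F (w # ws) \<longleftrightarrow> (\<exists>p. F w \<inter> (\<Union>v\<in>set ws. F v) \<subseteq> {p}) \<and> strippable F ws"

text \<open>
  The point at which a leaf is attached does not separate \<open>K\<close>, so \<open>K\<close> lies in the leaf or in the
  rest.
\<close>

lemma connected_subset_of_piece:
  fixes K :: "'a::t1_space set"
  assumes "strippable F ws" "ws \<noteq> []" "\<And>w. w \<in> set ws \<Longrightarrow> closed (F w)"
    and "K \<subseteq> (\<Union>w\<in>set ws. F w)" "connected K" "\<And>p. connected (K - {p})"
  shows "\<exists>w\<in>set ws. K \<subseteq> F w"
  using assms
proof (induction ws)
  case (Cons w ws)
  show ?case
  proof (cases "ws = []")
    case False
    obtain p where p: "F w \<inter> (\<Union>v\<in>set ws. F v) \<subseteq> {p}" using Cons.prems by auto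
    have "K \<subseteq> F w \<or> K \<subseteq> (\<Union>v\<in>set ws. F v)"
      by (rule connected_subset_of_two[OF _ _ p]) (use Cons.prems in auto)
    then show ?thesis using Cons False by auto
  qed (use Cons.prems in auto)
qed simp

section \<open>The attractor\<close>

definition white :: "(nat \<times> nat) set" where
  "white = {(3, 0), (3, 1), (3, 2), (3, 3), (3, 4), (0, 2), (1, 2), (1, 3), (2, 3), (4, 2)}"

text \<open>
  The similarity of the unit square onto the square of level \<open>n\<close> in column \<open>fst v\<close> and row \<open>snd v\<close>.
\<close>

definition zoom :: "nat \<Rightarrow> nat \<times> nat \<Rightarrow> point \<Rightarrow> point" where
  "zoom n v z = ((fst z + real (fst v)) / 5 ^ n, (snd z + real (snd v)) / 5 ^ n)"

fun refine :: "nat \<times> nat \<Rightarrow> nat \<times> nat \<Rightarrow> nat \<times> nat" where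
  "refine (i, j) (a, b) = (5 * i + a, 5 * j + b)"

primrec cells :: "nat \<Rightarrow> (nat \<times> nat) set" where
  "cells 0 = {(0, 0)}"
| "cells (Suc n) = (\<Union>v\<in>cells n. refine v ` white)"

definition unit_square :: "point set" where
  "unit_square = {0..1} \<times> {0..1}"

definition approx :: "nat \<Rightarrow> point set" where
  "approx n = (\<Union>v\<in>cells n. zoom n v ` unit_square)"

definition fractal :: "point set" where
  "fractal = (\<Inter>n. approx n)"

primrec exit_point :: "side \<Rightarrow> point" where
  "exit_point Left = (0, 1/2)"
| "exit_point Right = (1, 1/2)"
| "exit_point Top = (3/4, 1)"
| "exit_point Bottom = (3/4, 0)"

lemma white_bound: "(a, b) \<in> white \<Longrightarrow> a \<le> 4 \<and> b \<le> 4"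
  by (auto simp: white_def)

lemma finite_white: "finite white"
  by (simp add: white_def)

lemma zoom_refine: "zoom (Suc n) (refine v w) z = zoom n v (zoom 1 w z)"
  by (cases v; cases w) (simp add: zoom_def field_simps)

lemma refine_0 [simp]: "refine (0, 0) w = w"
  by (cases w) simp

lemma zoom_0 [simp]: "zoom 0 (0, 0) z = z"
  by (simp add: zoom_def)

lemma zoom_eq_iff: "zoom n v z = zoom n v z' \<longleftrightarrow> z = z'"
  by (auto simp: zoom_def prod_eq_iff)

lemma zoom_diff: "zoom n v z - zoom n v z' = (1 / 5 ^ n) *\<^sub>R (z - z')"
  by (simp add: zoom_def prod_eq_iff field_simps)

lemma dist_zoom: "dist (zoom n v z) (zoom n v z') = (1 / 5 ^ n) * dist z z'"
  by (simp add: dist_norm zoom_diff)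

lemma continuous_on_zoom [continuous_intros]: "continuous_on S (zoom n v)"
  unfolding zoom_def by (intro continuous_intros) auto

lemma zoom_white_unit_square: "w \<in> white \<Longrightarrow> zoom 1 w ` unit_square \<subseteq> unit_square"
  by (cases w) (auto simp: zoom_def unit_square_def dest!: white_bound)

lemma cells_bound: "(i, j) \<in> cells n \<Longrightarrow> i < 5 ^ n \<and> j < 5 ^ n"
proof (induction n arbitrary: i j)
  case (Suc n)
  then obtain k l a b where *: "(k, l) \<in> cells n" "(a, b) \<in> white" "i = 5 * k + a" "j = 5 * l + b"
    by auto
  then show ?case using Suc.IH[of k l] white_bound[of a b] by auto
qed simp

text \<open>
  A square of level \<open>n + 1\<close> lies in a square of level \<open>n\<close> at a position given by the pattern; but it
  also lies in a square of level 1 at a position of level \<open>n\<close>. The definition of the white squares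
  uses the first description, self-similarity the second.
\<close>

lemma cells_Suc_outer:
  "cells (Suc n) = {(5 ^ n * a + i, 5 ^ n * b + j) | a b i j. (a, b) \<in> white \<and> (i, j) \<in> cells n}"
    (is "_ = ?R n")
proof (induction n)
  case 0
  show ?case by auto
next
  case (Suc n)
  have shift: "refine (5 ^ n * a + i, 5 ^ n * b + j) (c, d) =
      (5 ^ Suc n * a + (5 * i + c), 5 ^ Suc n * b + (5 * j + d))" for a b c d i j
    by (simp add: algebra_simps)
  have "(\<Union>v\<in>?R n. refine v ` white) = ?R (Suc n)"
  proof (intro equalityI subsetI)
    fix x assume "x \<in> (\<Union>v\<in>?R n. refine v ` white)"
    then obtain a b i j c d where *: "(a, b) \<in> white" "(i, j) \<in> cells n" "(c, d) \<in> white"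
        "x = refine (5 ^ n * a + i, 5 ^ n * b + j) (c, d)" by auto
    have "(5 * i + c, 5 * j + d) \<in> cells (Suc n)"
      using *(2,3) unfolding cells.simps by (intro UN_I image_eqI) auto
    then show "x \<in> ?R (Suc n)" using * unfolding shift by blast
  next
    fix x assume "x \<in> ?R (Suc n)"
    then obtain a b k l where *: "(a, b) \<in> white" "(k, l) \<in> cells (Suc n)"
        "x = (5 ^ Suc n * a + k, 5 ^ Suc n * b + l)" by blast
    then obtain i j c d where **: "(i, j) \<in> cells n" "(c, d) \<in> white"
        "k = 5 * i + c" "l = 5 * j + d" by auto
    have "x = refine (5 ^ n * a + i, 5 ^ n * b + j) (c, d)" using * ** by (simp only: shift)
    then show "x \<in> (\<Union>v\<in>?R n. refine v ` white)" using * ** by blast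
  qed
  then show ?case by (rule trans[rotated]) (simp only: cells.simps(2)[of "Suc n"] Suc)
qed

lemma approx_0: "approx 0 = unit_square"
  by (simp add: approx_def)

lemma approx_Suc: "approx (Suc n) = (\<Union>w\<in>white. zoom 1 w ` approx n)"
proof -
  have "zoom (Suc n) (5 ^ n * a + i, 5 ^ n * b + j) z = zoom 1 (a, b) (zoom n (i, j) z)" for a b i j z
    by (simp add: zoom_def field_simps)
  then have eq: "zoom (Suc n) (5 ^ n * a + i, 5 ^ n * b + j) ` S = zoom 1 (a, b) ` zoom n (i, j) ` S"
    for a b i j S by (simp add: image_image)
  show ?thesis
  proof (intro equalityI subsetI)
    fix x assume "x \<in> approx (Suc n)"
    then obtain a b i j where "(a, b) \<in> white" "(i, j) \<in> cells n"
        "x \<in> zoom (Suc n) (5 ^ n * a + i, 5 ^ n * b + j) ` unit_square"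
      unfolding approx_def cells_Suc_outer by blast
    then show "x \<in> (\<Union>w\<in>white. zoom 1 w ` approx n)"
      unfolding eq approx_def by blast
  next
    fix x assume "x \<in> (\<Union>w\<in>white. zoom 1 w ` approx n)"
    then obtain w v where w: "w \<in> white" "v \<in> cells n" "x \<in> zoom 1 w ` zoom n v ` unit_square"
      unfolding approx_def by blast
    obtain a b i j where "w = (a, b)" "v = (i, j)" by fastforce
    then have "x \<in> zoom (Suc n) (5 ^ n * a + i, 5 ^ n * b + j) ` unit_square"
        "(5 ^ n * a + i, 5 ^ n * b + j) \<in> cells (Suc n)"
      using w unfolding eq cells_Suc_outer by blast+
    then show "x \<in> approx (Suc n)" unfolding approx_def by blast
  qed
qed

lemma zoom_approx: "w \<in> white \<Longrightarrow> z \<in> approx n \<Longrightarrow> zoom 1 w z \<in> approx (Suc n)"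
  unfolding approx_Suc by blast

lemma approx_Suc_subset: "approx (Suc n) \<subseteq> approx n"
proof -
  have sub: "zoom (Suc n) (refine v w) ` unit_square \<subseteq> zoom n v ` unit_square" if "w \<in> white" for v w
    unfolding zoom_refine using zoom_white_unit_square[OF that] by blast
  show ?thesis
    unfolding approx_def cells.simps
  proof (intro UN_least)
    fix u assume "u \<in> (\<Union>v\<in>cells n. refine v ` white)"
    then obtain v w where "u = refine v w" "v \<in> cells n" "w \<in> white" by blast
    then show "zoom (Suc n) u ` unit_square \<subseteq> (\<Union>v\<in>cells n. zoom n v ` unit_square)"
      using sub[of w v] by blast
  qed
qed

lemma approx_antimono: "n \<le> k \<Longrightarrow> approx k \<subseteq> approx n"
  using lift_Suc_antimono_le[of approx] approx_Suc_subset by blast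

lemma fractal_subset_unit_square: "fractal \<subseteq> unit_square"
  unfolding fractal_def using approx_0 by blast

lemma fractal_bounds: "z \<in> fractal \<Longrightarrow> 0 \<le> fst z \<and> fst z \<le> 1 \<and> 0 \<le> snd z \<and> snd z \<le> 1"
  using fractal_subset_unit_square by (auto simp: unit_square_def)

text \<open>
  For the inclusion from left to right, a point lies at each level in one of finitely many copies.
  If every copy failed to contain it at some level, all would fail at the largest of these levels,
  because the approximations decrease.
\<close>

lemma fractal_self_similar: "fractal = (\<Union>w\<in>white. zoom 1 w ` fractal)"
proof
  show "(\<Union>w\<in>white. zoom 1 w ` fractal) \<subseteq> fractal"
  proof (intro UN_least image_subsetI)
    fix w z assume w: "w \<in> white" "z \<in> fractal"
    have "zoom 1 w z \<in> approx (Suc n)" for n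
      using w by (auto simp: approx_Suc fractal_def)
    then show "zoom 1 w z \<in> fractal"
      using approx_Suc_subset unfolding fractal_def by blast
  qed
  show "fractal \<subseteq> (\<Union>w\<in>white. zoom 1 w ` fractal)"
  proof
    fix x assume x: "x \<in> fractal"
    show "x \<in> (\<Union>w\<in>white. zoom 1 w ` fractal)"
    proof (rule ccontr)
      assume no: "x \<notin> (\<Union>w\<in>white. zoom 1 w ` fractal)"
      have "\<exists>n. x \<notin> zoom 1 w ` approx n" if "w \<in> white" for w
      proof (rule ccontr)
        assume "\<nexists>n. x \<notin> zoom 1 w ` approx n"
        then have all: "\<And>n. x \<in> zoom 1 w ` approx n" by blast
        then obtain z where z: "x = zoom 1 w z" by blast
        have "z \<in> approx n" for n using all[of n] z by (auto simp: zoom_eq_iff)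
        then show False using no that z by (auto simp: fractal_def)
      qed
      then obtain N where N: "\<And>w. w \<in> white \<Longrightarrow> x \<notin> zoom 1 w ` approx (N w)" by metis
      have "x \<in> approx (Suc (Max (N ` white)))" using x by (auto simp: fractal_def)
      then obtain w where w: "w \<in> white" "x \<in> zoom 1 w ` approx (Max (N ` white))"
        by (auto simp: approx_Suc)
      then have "approx (Max (N ` white)) \<subseteq> approx (N w)"
        by (intro approx_antimono Max_ge) (auto simp: finite_white)
      then show False using N[OF w(1)] w(2) by blast
    qed
  qed
qed

lemma fractal_cases:
  assumes "x \<in> fractal"
  obtains w z where "w \<in> white" "z \<in> fractal" "x = zoom 1 w z"
  using assms fractal_self_similar by blast

lemma fractal_cells: "fractal = (\<Union>v\<in>cells n. zoom n v ` fractal)"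
proof (induction n)
  case (Suc n)
  have "fractal = (\<Union>v\<in>cells n. zoom n v ` (\<Union>w\<in>white. zoom 1 w ` fractal))"
    using Suc fractal_self_similar by simp
  also have "\<dots> = (\<Union>v\<in>cells (Suc n). zoom (Suc n) v ` fractal)"
    unfolding cells.simps by (simp add: image_UN image_image zoom_refine del: One_nat_def) blast
  finally show ?case .
qed simp

lemma zoom_fractal: "v \<in> cells n \<Longrightarrow> z \<in> fractal \<Longrightarrow> zoom n v z \<in> fractal"
  using fractal_cells by blast

lemma white_cells: "white = cells 1"
  by simp

lemma compact_approx: "compact (approx n)"
proof -
  have "compact (zoom n v ` unit_square)" for n v
    by (intro compact_continuous_image continuous_on_zoom)
       (simp add: unit_square_def compact_Times)
  moreover have "finite (cells n)" for n
    by (induction n) (auto simp: finite_white)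
  ultimately show ?thesis
    unfolding approx_def by (intro compact_UN) auto
qed

lemma compact_fractal: "compact fractal"
  unfolding fractal_def by (rule compact_Inter) (auto simp: compact_approx)

lemma spine_approx: "0 \<le> y \<Longrightarrow> y \<le> 1 \<Longrightarrow> (3/4, y) \<in> approx n"
proof (induction n arbitrary: y)
  case 0
  then show ?case by (simp add: approx_0 unit_square_def)
next
  case (Suc n)
  have *: "(3/4, y) \<in> approx (Suc n)" if "(3, j) \<in> white" "real j \<le> 5 * y" "5 * y \<le> real j + 1" for j
  proof -
    have "(3/4, 5 * y - real j) \<in> approx n" using that by (intro Suc.IH) auto
    then show ?thesis
      using zoom_approx[of "(3, j)" "(3/4, 5 * y - real j)" n] that(1) by (simp add: zoom_def)
  qed
  have "y \<le> 1/5 \<or> 1/5 \<le> y \<and> y \<le> 2/5 \<or> 2/5 \<le> y \<and> y \<le> 3/5 \<or> 3/5 \<le> y \<and> y \<le> 4/5 \<or> 4/5 \<le> y"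
    by linarith
  then show ?case
    using Suc.prems *[of 0] *[of 1] *[of 2] *[of 3] *[of 4] by (auto simp: white_def)
qed

lemma exit_point_fractal: "exit_point d \<in> fractal"
proof -
  have "(0, 1/2) \<in> approx n \<and> (1, 1/2) \<in> approx n" for n
  proof (induction n)
    case 0
    then show ?case by (simp add: approx_0 unit_square_def)
  next
    case (Suc n)
    then show ?case
      using zoom_approx[of "(0, 2)" "(0, 1/2)" n] zoom_approx[of "(4, 2)" "(1, 1/2)" n]
      by (simp add: white_def zoom_def)
  qed
  then show ?thesis by (cases d) (auto simp: fractal_def spine_approx)
qed

lemma eq_if_abs_diff_le_powers:
  fixes a b :: real
  assumes "\<And>n. \<bar>a - b\<bar> \<le> (1/5) ^ n"
  shows "a = b"
proof (rule ccontr)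
  assume "a \<noteq> b"
  then obtain n where "(1/5) ^ n < \<bar>a - b\<bar>" using real_arch_pow_inv[of "\<bar>a - b\<bar>" "1/5"] by auto
  then show False using assms[of n] by simp
qed

text \<open>
  Only one white square touches each side of the unit square. So a point on a side lies in that
  square, and its magnification lies on the same side: its distance from the exit is divided by 5 at
  each step.
\<close>

lemma fractal_left: "z \<in> fractal \<Longrightarrow> fst z = 0 \<Longrightarrow> z = exit_point Left"
proof -
  assume "z \<in> fractal" "fst z = 0"
  then have "\<bar>snd z - 1/2\<bar> \<le> (1/5) ^ n" for n
  proof (induction n arbitrary: z)
    case 0
    then show ?case using fractal_bounds[of z] by (simp add: abs_le_iff)
  next
    case (Suc n)
    then obtain w y where w: "w \<in> white" "y \<in> fractal" "z = zoom 1 w y" by (meson fractal_cases)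
    then have "fst y = 0" "w = (0, 2)"
      using Suc.prems fractal_bounds[of y] by (auto simp: zoom_def white_def add_nonneg_eq_0_iff)
    then show ?case using Suc.IH[of y] w by (auto simp: zoom_def abs_le_iff field_simps)
  qed
  then have "snd z = 1/2" by (rule eq_if_abs_diff_le_powers)
  then show ?thesis using \<open>fst z = 0\<close> by (simp add: prod_eq_iff)
qed

lemma fractal_right: "z \<in> fractal \<Longrightarrow> fst z = 1 \<Longrightarrow> z = exit_point Right"
proof -
  assume "z \<in> fractal" "fst z = 1"
  then have "\<bar>snd z - 1/2\<bar> \<le> (1/5) ^ n" for n
  proof (induction n arbitrary: z)
    case 0
    then show ?case using fractal_bounds[of z] by (simp add: abs_le_iff)
  next
    case (Suc n)
    then obtain w y where w: "w \<in> white" "y \<in> fractal" "z = zoom 1 w y" by (meson fractal_cases)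
    then have "fst y = 1" "w = (4, 2)"
      using Suc.prems fractal_bounds[of y] by (auto simp: zoom_def white_def)
    then show ?case using Suc.IH[of y] w by (auto simp: zoom_def abs_le_iff field_simps)
  qed
  then have "snd z = 1/2" by (rule eq_if_abs_diff_le_powers)
  then show ?thesis using \<open>fst z = 1\<close> by (simp add: prod_eq_iff)
qed

lemma fractal_bottom: "z \<in> fractal \<Longrightarrow> snd z = 0 \<Longrightarrow> z = exit_point Bottom"
proof -
  assume "z \<in> fractal" "snd z = 0"
  then have "\<bar>fst z - 3/4\<bar> \<le> (1/5) ^ n" for n
  proof (induction n arbitrary: z)
    case 0
    then show ?case using fractal_bounds[of z] by (simp add: abs_le_iff)
  next
    case (Suc n)
    then obtain w y where w: "w \<in> white" "y \<in> fractal" "z = zoom 1 w y" by (meson fractal_cases)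
    then have "snd y = 0" "w = (3, 0)"
      using Suc.prems fractal_bounds[of y] by (auto simp: zoom_def white_def add_nonneg_eq_0_iff)
    then show ?case using Suc.IH[of y] w by (auto simp: zoom_def abs_le_iff field_simps)
  qed
  then have "fst z = 3/4" by (rule eq_if_abs_diff_le_powers)
  then show ?thesis using \<open>snd z = 0\<close> by (simp add: prod_eq_iff)
qed

lemma fractal_top: "z \<in> fractal \<Longrightarrow> snd z = 1 \<Longrightarrow> z = exit_point Top"
proof -
  assume "z \<in> fractal" "snd z = 1"
  then have "\<bar>fst z - 3/4\<bar> \<le> (1/5) ^ n" for n
  proof (induction n arbitrary: z)
    case 0
    then show ?case using fractal_bounds[of z] by (simp add: abs_le_iff)
  next
    case (Suc n)
    then obtain w y where w: "w \<in> white" "y \<in> fractal" "z = zoom 1 w y" by (meson fractal_cases)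
    then have "snd y = 1" "w = (3, 4)"
      using Suc.prems fractal_bounds[of y] by (auto simp: zoom_def white_def)
    then show ?case using Suc.IH[of y] w by (auto simp: zoom_def abs_le_iff field_simps)
  qed
  then have "fst z = 3/4" by (rule eq_if_abs_diff_le_powers)
  then show ?thesis using \<open>snd z = 1\<close> by (simp add: prod_eq_iff)
qed

text \<open>
  The coordinates of two points of the unit square differ by an integer only if they agree or lie on
  opposite sides. On the vertical sides the only points of the attractor have the same height, and
  on the horizontal sides the same abscissa, so squares that meet only in a corner contribute
  nothing.
\<close>

lemma copies_meet:
  assumes x: "x \<in> zoom n (i, j) ` fractal" "x \<in> zoom n (k, l) ` fractal" and ne: "(i, j) \<noteq> (k, l)"
  shows "k = Suc i \<and> l = j \<and> x = zoom n (i, j) (exit_point Right) \<or>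
         i = Suc k \<and> l = j \<and> x = zoom n (i, j) (exit_point Left) \<or>
         k = i \<and> l = Suc j \<and> x = zoom n (i, j) (exit_point Top) \<or>
         k = i \<and> j = Suc l \<and> x = zoom n (i, j) (exit_point Bottom)"
proof -
  obtain y z where y: "y \<in> fractal" "x = zoom n (i, j) y" and z: "z \<in> fractal" "x = zoom n (k, l) z"
    using x by blast
  have eq: "fst y + real i = fst z + real k" "snd y + real j = snd z + real l"
    using y z by (auto simp: zoom_def)
  note b = fractal_bounds[OF y(1)] fractal_bounds[OF z(1)]
  have "k \<le> Suc i" "i \<le> Suc k" "l \<le> Suc j" "j \<le> Suc l" using eq b by linarith+
  then consider "k = Suc i" | "i = Suc k" | "k = i" "l = Suc j" | "k = i" "j = Suc l"
    using ne by fastforce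
  then show ?thesis
  proof cases
    case 1
    then have "fst y = 1" "fst z = 0" using eq b by auto
    then have "y = exit_point Right" "z = exit_point Left"
      using fractal_right fractal_left y z by blast+
    then show ?thesis using eq 1 y by auto
  next
    case 2
    then have "fst y = 0" "fst z = 1" using eq b by auto
    then have "y = exit_point Left" "z = exit_point Right"
      using fractal_right fractal_left y z by blast+
    then show ?thesis using eq 2 y by auto
  next
    case 3
    then have "snd y = 1" using eq b by auto
    then show ?thesis using fractal_top[OF y(1)] 3 y by auto
  next
    case 4
    then have "snd y = 0" using eq b by auto
    then show ?thesis using fractal_bottom[OF y(1)] 4 y by auto
  qed
qed

section \<open>The attractor contains no simple closed curve\<close>

lemma copy_meets_at_one_exit:
  assumes "\<And>k l. (k, l) \<in> V \<Longrightarrow> (k, l) \<noteq> (i, j) \<and>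
      (k = Suc i \<and> l = j \<longrightarrow> d = Right) \<and> (i = Suc k \<and> l = j \<longrightarrow> d = Left) \<and>
      (k = i \<and> l = Suc j \<longrightarrow> d = Top) \<and> (k = i \<and> j = Suc l \<longrightarrow> d = Bottom)"
  shows "\<exists>p. zoom 1 (i, j) ` fractal \<inter> (\<Union>v\<in>V. zoom 1 v ` fractal) \<subseteq> {p}"
proof (intro exI subsetI)
  fix x assume x: "x \<in> zoom 1 (i, j) ` fractal \<inter> (\<Union>v\<in>V. zoom 1 v ` fractal)"
  then obtain v where v: "v \<in> V" "x \<in> zoom 1 v ` fractal" by blast
  obtain k l where kl: "v = (k, l)" by fastforce
  from assms[of k l] v have *: "(i, j) \<noteq> (k, l)"
      "k = Suc i \<and> l = j \<longrightarrow> d = Right" "i = Suc k \<and> l = j \<longrightarrow> d = Left"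
      "k = i \<and> l = Suc j \<longrightarrow> d = Top" "k = i \<and> j = Suc l \<longrightarrow> d = Bottom"
    unfolding kl by metis+
  from copies_meet[OF IntD1[OF x] v(2)[unfolded kl] *(1)] *(2-5)
  show "x \<in> {zoom 1 (i, j) (exit_point d)}"
    by (elim disjE) simp_all
qed

lemma no_cut_point_in_copy:
  assumes "K \<subseteq> fractal" "connected K" "\<And>p. connected (K - {p})"
  shows "\<exists>w\<in>white. K \<subseteq> zoom 1 w ` fractal"
proof -
  \<comment> \<open>Every square is a leaf of the tree that remains when the earlier ones are removed: first the
    left arm from its end, then the right arm, then the column from the bottom.\<close>
  define ws :: "(nat \<times> nat) list" where
    "ws = [(0, 2), (1, 2), (1, 3), (2, 3), (4, 2), (3, 0), (3, 1), (3, 2), (3, 3), (3, 4)]"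
  have set_ws: "set ws = white" by (auto simp: ws_def white_def)
  have "strippable (\<lambda>w. zoom 1 w ` fractal) ws"
    unfolding ws_def strippable.simps
    by (intro conjI TrueI;
        ((rule copy_meets_at_one_exit[where d = Right], force) |
        (rule copy_meets_at_one_exit[where d = Top], force) |
        (rule copy_meets_at_one_exit[where d = Left], force)))
  moreover have "closed (zoom 1 w ` fractal)" for w
    by (intro compact_imp_closed compact_continuous_image continuous_on_zoom compact_fractal)
  moreover have "K \<subseteq> (\<Union>w\<in>set ws. zoom 1 w ` fractal)"
    using assms(1) fractal_self_similar set_ws by auto
  moreover have "ws \<noteq> []" by (simp add: ws_def)
  ultimately have "\<exists>w\<in>set ws. K \<subseteq> zoom 1 w ` fractal"
    using assms(2,3) by (intro connected_subset_of_piece)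
  then show ?thesis by (simp only: set_ws)
qed

text \<open>
  By \<open>no_cut_point_in_copy\<close>, the magnified set has the same properties again, and all these sets lie
  in the unit square.
\<close>

lemma no_cut_point_trivial:
  assumes "K \<subseteq> fractal" "connected K" "\<And>p. connected (K - {p})" "x \<in> K" "y \<in> K"
  shows "x = y"
proof -
  have "\<bar>fst x - fst y\<bar> \<le> (1/5) ^ n \<and> \<bar>snd x - snd y\<bar> \<le> (1/5) ^ n" for n
    using assms
  proof (induction n arbitrary: K x y)
    case 0
    then have "x \<in> fractal" "y \<in> fractal" by auto
    then show ?case using fractal_bounds[of x] fractal_bounds[of y] by (auto simp: abs_le_iff)
  next
    case (Suc n)
    obtain w where w: "w \<in> white" "K \<subseteq> zoom 1 w ` fractal"
      using no_cut_point_in_copy Suc.prems by meson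
    define u :: "point \<Rightarrow> point" where "u z = (5 * fst z - real (fst w), 5 * snd z - real (snd w))" for z
    have inv: "u (zoom 1 w z) = z" "zoom 1 w (u z) = z" for z
      by (simp_all add: u_def zoom_def prod_eq_iff field_simps)
    have cont: "continuous_on S u" for S unfolding u_def by (intro continuous_intros)
    have "u ` K \<subseteq> fractal"
    proof (rule image_subsetI)
      fix z assume "z \<in> K"
      then obtain z' where "z' \<in> fractal" "z = zoom 1 w z'" using w(2) by blast
      then show "u z \<in> fractal" by (simp only: inv)
    qed
    moreover have "connected (u ` K)" using cont Suc.prems(2) by (rule connected_continuous_image)
    moreover have "connected (u ` K - {p})" for p
    proof -
      have "u ` (K - {zoom 1 w p}) = u ` K - u ` {zoom 1 w p}"
        by (rule inj_on_image_set_diff[of u UNIV]) (auto intro: inj_on_inverseI[of _ "zoom 1 w"] inv)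
      then have "u ` K - {p} = u ` (K - {zoom 1 w p})" by (simp only: image_insert image_empty inv)
      then show ?thesis
        using connected_continuous_image[OF cont Suc.prems(3)] by (simp only:)
    qed
    ultimately have "\<bar>fst (u x) - fst (u y)\<bar> \<le> (1/5) ^ n \<and> \<bar>snd (u x) - snd (u y)\<bar> \<le> (1/5) ^ n"
      using imageI[OF Suc.prems(4), of u] imageI[OF Suc.prems(5), of u] by (rule Suc.IH)
    moreover have "\<bar>fst (u x) - fst (u y)\<bar> = 5 * \<bar>fst x - fst y\<bar>"
        "\<bar>snd (u x) - snd (u y)\<bar> = 5 * \<bar>snd x - snd y\<bar>"
      by (simp_all add: u_def abs_if)
    ultimately show ?case by simp
  qed
  then show ?thesis by (intro prod_eqI eq_if_abs_diff_le_powers) auto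
qed

lemma fractal_no_simple_closed_curve:
  assumes "simple_path c" "pathfinish c = pathstart c"
  shows "\<not> path_image c \<subseteq> fractal"
proof
  assume sub: "path_image c \<subseteq> fractal"
  have "c 0 = c (1/2)"
    using no_cut_point_trivial[OF sub connected_simple_path_image[OF assms(1)]
        simple_closed_curve_no_cut_point[OF assms], of "c 0" "c (1/2)"]
    by (auto simp: path_image_def)
  moreover have "0 \<in> {0..1::real}" "1/2 \<in> {0..1::real}" by auto
  ultimately show False using assms(1) unfolding simple_path_def loop_free_def by fastforce
qed

section \<open>Existence of arcs between the exits\<close>

text \<open>
  The paths \<open>g n\<close> converge uniformly by the M-test, and for each \<open>n\<close> almost all of them run in the
  closed set \<open>K n\<close>.
\<close>

lemma path_limit:
  fixes g :: "nat \<Rightarrow> real \<Rightarrow> 'a::banach"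
  assumes path: "\<And>n. path (g n)" and ends: "\<And>n. pathstart (g n) = a" "\<And>n. pathfinish (g n) = b"
    and close: "\<And>n t. t \<in> {0..1} \<Longrightarrow> dist (g n t) (g (Suc n) t) \<le> M n" and M: "summable M"
    and K: "\<And>n. closed (K n)" "\<And>n k. n \<le> k \<Longrightarrow> K k \<subseteq> K n" "\<And>n. path_image (g n) \<subseteq> K n"
  shows "path_component (\<Inter>n. K n) a b"
proof -
  define L where "L t = g 0 t + (\<Sum>i. g (Suc i) t - g i t)" for t
  have sums: "uniform_limit {0..1} (\<lambda>n t. \<Sum>i<n. g (Suc i) t - g i t) (\<lambda>t. \<Sum>i. g (Suc i) t - g i t) sequentially"
    by (rule Weierstrass_m_test[where M = M]) (use close M in \<open>auto simp: dist_norm norm_minus_commute\<close>)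
  have telescope: "g 0 t + (\<Sum>i<n. g (Suc i) t - g i t) = g n t" for n t
    using sum_lessThan_telescope[of "\<lambda>i. g i t" n] by simp
  have "uniform_limit {0..1} (\<lambda>n t. g 0 t + (\<Sum>i<n. g (Suc i) t - g i t)) L sequentially"
    unfolding L_def by (intro uniform_limit_intros sums)
  then have lim: "uniform_limit {0..1} g L sequentially"
    unfolding telescope .
  have cont: "continuous_on {0..1} L"
    by (rule uniform_limit_theorem[OF _ lim]) (use path in \<open>auto simp: path_def\<close>)
  have ptw: "(\<lambda>n. g n t) \<longlonglongrightarrow> L t" if "t \<in> {0..1}" for t
    using tendsto_uniform_limitI[OF lim that] .
  have "L 0 = a" "L 1 = b"
    using LIMSEQ_unique[OF ptw[of 0]] LIMSEQ_unique[OF ptw[of 1]] ends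
    by (auto simp: pathstart_def pathfinish_def)
  moreover have "L t \<in> K n" if t: "t \<in> {0..1}" for t n
  proof (rule Lim_in_closed_set[OF K(1) _ _ ptw[OF t]])
    have "g k t \<in> K n" if "n \<le> k" for k
      using K(3)[of k] K(2)[OF that] t unfolding path_image_def by blast
    then show "\<forall>\<^sub>F k in sequentially. g k t \<in> K n" by (auto simp: eventually_sequentially)
  qed simp
  ultimately show ?thesis
    unfolding path_component_def using cont
    by (intro exI[of _ L]) (auto simp: path_def path_image_def pathstart_def pathfinish_def)
qed

definition uniformly_within :: "real \<Rightarrow> (real \<Rightarrow> point) \<Rightarrow> (real \<Rightarrow> point) \<Rightarrow> bool" where
  "uniformly_within d g h \<longleftrightarrow> (\<forall>t\<in>{0..1}. dist (g t) (h t) \<le> d)"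

lemma uniformly_within_refl: "0 \<le> d \<Longrightarrow> uniformly_within d g g"
  by (simp add: uniformly_within_def)

lemma uniformly_within_join:
  "uniformly_within d g g' \<Longrightarrow> uniformly_within d h h' \<Longrightarrow> uniformly_within d (g +++ h) (g' +++ h')"
  by (auto simp: uniformly_within_def joinpaths_def)

lemma uniformly_within_reversepath:
  "uniformly_within d g g' \<Longrightarrow> uniformly_within d (reversepath g) (reversepath g')"
  by (auto simp: uniformly_within_def reversepath_def)

lemma uniformly_within_zoom:
  "uniformly_within d g g' \<Longrightarrow> uniformly_within (d / 5) (zoom 1 w \<circ> g) (zoom 1 w \<circ> g')"
  by (auto simp: uniformly_within_def dist_zoom)

text \<open>
  The points at which the arcs from the left and from the right exit reach the column: the fixed
  points of the maps of the squares (3,3) and (3,2), in which these arcs end at every level.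
\<close>

definition left_foot :: point where "left_foot = (3/4, 3/4)"

definition right_foot :: point where "right_foot = (3/4, 1/2)"

text \<open>
  Here and below, \<open>a\<close> stands for a path from the left exit to its foot and \<open>b\<close> for a path from the
  right exit to its foot. The steps substitute them into the squares through which the arms of the
  pattern pass.
\<close>

definition crossing :: "(real \<Rightarrow> point) \<Rightarrow> (real \<Rightarrow> point) \<Rightarrow> real \<Rightarrow> point" where
  "crossing a b = a +++ linepath left_foot right_foot +++ reversepath b"

definition left_step :: "(real \<Rightarrow> point) \<Rightarrow> (real \<Rightarrow> point) \<Rightarrow> real \<Rightarrow> point" where
  "left_step a b =
    (zoom 1 (0, 2) \<circ> crossing a b) +++
    (zoom 1 (1, 2) \<circ> (a +++ linepath left_foot (exit_point Top))) +++
    (zoom 1 (1, 3) \<circ> (linepath (exit_point Bottom) right_foot +++ reversepath b)) +++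
    (zoom 1 (2, 3) \<circ> crossing a b) +++
    (zoom 1 (3, 3) \<circ> a)"

definition right_step :: "(real \<Rightarrow> point) \<Rightarrow> (real \<Rightarrow> point) \<Rightarrow> real \<Rightarrow> point" where
  "right_step a b = (zoom 1 (4, 2) \<circ> reversepath (crossing a b)) +++ (zoom 1 (3, 2) \<circ> b)"

text \<open>
  The vertical segments are the same for both pairs, and everything else is shrunk by 5.
\<close>

lemma uniformly_within_steps:
  assumes "uniformly_within d a a'" "uniformly_within d b b'" "0 \<le> d"
  shows "uniformly_within (d / 5) (left_step a b) (left_step a' b')"
    and "uniformly_within (d / 5) (right_step a b) (right_step a' b')"
proof -
  note close = uniformly_within_join uniformly_within_zoom uniformly_within_reversepath
    uniformly_within_refl[OF assms(3)] assms(1,2)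
  have c: "uniformly_within d (crossing a b) (crossing a' b')"
    unfolding crossing_def by (intro close)
  show "uniformly_within (d / 5) (left_step a b) (left_step a' b')"
    unfolding left_step_def by (intro close c)
  show "uniformly_within (d / 5) (right_step a b) (right_step a' b')"
    unfolding right_step_def by (intro close c)
qed

definition joins :: "point set \<Rightarrow> point \<Rightarrow> point \<Rightarrow> (real \<Rightarrow> point) \<Rightarrow> bool" where
  "joins S x y g \<longleftrightarrow> path g \<and> path_image g \<subseteq> S \<and> pathstart g = x \<and> pathfinish g = y"

lemma joins_join: "joins S x y g \<Longrightarrow> joins S y z h \<Longrightarrow> joins S x z (g +++ h)"
  by (auto simp: joins_def path_image_join)

lemma joins_reversepath: "joins S x y g \<Longrightarrow> joins S y x (reversepath g)"
  by (auto simp: joins_def)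

lemma joins_zoom:
  assumes "joins (approx n) x y g" "w \<in> white" "zoom 1 w x = x'" "zoom 1 w y = y'"
  shows "joins (approx (Suc n)) x' y' (zoom 1 w \<circ> g)"
proof -
  have g: "path g" "path_image g \<subseteq> approx n" "pathstart g = x" "pathfinish g = y"
    using assms(1) by (auto simp: joins_def)
  have "path (zoom 1 w \<circ> g)" using g(1) by (intro path_continuous_image continuous_on_zoom)
  moreover have "path_image (zoom 1 w \<circ> g) \<subseteq> approx (Suc n)"
    unfolding path_image_compose using g(2) zoom_approx[OF assms(2)] by blast
  ultimately show ?thesis
    using g(3,4) assms(3,4) by (simp add: joins_def pathstart_compose pathfinish_compose)
qed

lemma joins_spine:
  assumes "0 \<le> y" "y \<le> 1" "0 \<le> y'" "y' \<le> 1"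
  shows "joins (approx n) (3/4, y) (3/4, y') (linepath (3/4, y) (3/4, y'))"
proof -
  have "closed_segment (3/4, y) (3/4, y') \<subseteq> {3/4} \<times> {0..1}"
    using assms by (intro closed_segment_subset convex_Times) auto
  then have "closed_segment (3/4, y) (3/4, y') \<subseteq> approx n"
    using spine_approx by fastforce
  then show ?thesis by (simp add: joins_def)
qed

lemma joins_steps:
  assumes a: "joins (approx n) (exit_point Left) left_foot a"
    and b: "joins (approx n) (exit_point Right) right_foot b"
  shows "joins (approx (Suc n)) (exit_point Left) left_foot (left_step a b)"
    and "joins (approx (Suc n)) (exit_point Right) right_foot (right_step a b)"
proof -
  have feet: "joins (approx n) left_foot right_foot (linepath left_foot right_foot)"
    and top: "joins (approx n) left_foot (exit_point Top) (linepath left_foot (exit_point Top))"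
    and bottom: "joins (approx n) (exit_point Bottom) right_foot (linepath (exit_point Bottom) right_foot)"
    unfolding left_foot_def right_foot_def exit_point.simps by (intro joins_spine; simp)+
  have LR: "joins (approx n) (exit_point Left) (exit_point Right) (crossing a b)"
    unfolding crossing_def by (intro joins_join[OF a] joins_join[OF feet] joins_reversepath b)
  note simps = zoom_def white_def left_foot_def right_foot_def
  show "joins (approx (Suc n)) (exit_point Left) left_foot (left_step a b)"
    unfolding left_step_def
  proof (intro joins_join)
    show "joins (approx (Suc n)) (exit_point Left) (1/5, 1/2) (zoom 1 (0, 2) \<circ> crossing a b)"
      by (rule joins_zoom[OF LR]) (auto simp: simps)
    show "joins (approx (Suc n)) (1/5, 1/2) (7/20, 3/5)
        (zoom 1 (1, 2) \<circ> (a +++ linepath left_foot (exit_point Top)))"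
      by (rule joins_zoom[OF joins_join[OF a top]]) (auto simp: simps)
    show "joins (approx (Suc n)) (7/20, 3/5) (2/5, 7/10)
        (zoom 1 (1, 3) \<circ> (linepath (exit_point Bottom) right_foot +++ reversepath b))"
      by (rule joins_zoom[OF joins_join[OF bottom joins_reversepath[OF b]]]) (auto simp: simps)
    show "joins (approx (Suc n)) (2/5, 7/10) (3/5, 7/10) (zoom 1 (2, 3) \<circ> crossing a b)"
      by (rule joins_zoom[OF LR]) (auto simp: simps)
    show "joins (approx (Suc n)) (3/5, 7/10) left_foot (zoom 1 (3, 3) \<circ> a)"
      by (rule joins_zoom[OF a]) (auto simp: simps)
  qed
  show "joins (approx (Suc n)) (exit_point Right) right_foot (right_step a b)"
    unfolding right_step_def
  proof (rule joins_join)
    show "joins (approx (Suc n)) (exit_point Right) (4/5, 1/2) (zoom 1 (4, 2) \<circ> reversepath (crossing a b))"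
      by (rule joins_zoom[OF joins_reversepath[OF LR]]) (auto simp: simps)
    show "joins (approx (Suc n)) (4/5, 1/2) right_foot (zoom 1 (3, 2) \<circ> b)"
      by (rule joins_zoom[OF b]) (auto simp: simps)
  qed
qed

primrec arms :: "nat \<Rightarrow> (real \<Rightarrow> point) \<times> (real \<Rightarrow> point)" where
  "arms 0 = (linepath (exit_point Left) left_foot, linepath (exit_point Right) right_foot)"
| "arms (Suc n) = (left_step (fst (arms n)) (snd (arms n)), right_step (fst (arms n)) (snd (arms n)))"

lemma arms_join:
  "joins (approx n) (exit_point Left) left_foot (fst (arms n)) \<and>
   joins (approx n) (exit_point Right) right_foot (snd (arms n))"
proof (induction n)
  case 0
  have "convex unit_square" unfolding unit_square_def by (intro convex_Times) auto
  then have "joins (approx 0) x y (linepath x y)" if "x \<in> unit_square" "y \<in> unit_square" for x y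
    using that closed_segment_subset[of x unit_square y] by (simp add: joins_def approx_0)
  moreover have "exit_point d \<in> unit_square" for d by (cases d) (auto simp: unit_square_def)
  moreover have "left_foot \<in> unit_square" "right_foot \<in> unit_square"
    by (auto simp: unit_square_def left_foot_def right_foot_def)
  ultimately show ?case by (simp only: arms.simps fst_conv snd_conv)
next
  case (Suc n)
  show ?case
    unfolding arms.simps fst_conv snd_conv
    using joins_steps[OF Suc[THEN conjunct1] Suc[THEN conjunct2]] by (rule conjI)
qed

lemma arms_within:
  "uniformly_within (2 * (1/5) ^ n) (fst (arms n)) (fst (arms (Suc n))) \<and>
   uniformly_within (2 * (1/5) ^ n) (snd (arms n)) (snd (arms (Suc n)))"
proof (induction n)
  case 0
  have "dist x y \<le> 2" if "x \<in> unit_square" "y \<in> unit_square" for x y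
  proof -
    have "dist x y \<le> dist (fst x) (fst y) + dist (snd x) (snd y)"
      unfolding dist_prod_def by (rule sqrt_sum_squares_le_sum) auto
    also have "\<dots> \<le> 2" using that by (auto simp: unit_square_def dist_real_def)
    finally show ?thesis .
  qed
  moreover have "fst (arms n) t \<in> unit_square \<and> snd (arms n) t \<in> unit_square" if "t \<in> {0..1}" for n t
    using arms_join[of n] approx_antimono[of 0 n] that unfolding joins_def path_image_def approx_0 by blast
  ultimately show ?case by (simp add: uniformly_within_def del: arms.simps)
next
  case (Suc n)
  then show ?case
    using uniformly_within_steps[of "2 * (1/5) ^ n" "fst (arms n)" "fst (arms (Suc n))"
        "snd (arms n)" "snd (arms (Suc n))"]
    unfolding arms.simps(2)[of n, symmetric] by (simp del: arms.simps) simp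
qed

lemma arms_limit:
  "path_component fractal (exit_point Left) left_foot"
  "path_component fractal (exit_point Right) right_foot"
proof -
  have M: "summable (\<lambda>n. 2 * (1/5) ^ n :: real)"
    by (intro summable_mult summable_geometric) simp
  have K: "closed (approx n)" for n by (intro compact_imp_closed compact_approx)
  have l: "path (fst (arms n))" "pathstart (fst (arms n)) = exit_point Left"
      "pathfinish (fst (arms n)) = left_foot" "path_image (fst (arms n)) \<subseteq> approx n"
    and r: "path (snd (arms n))" "pathstart (snd (arms n)) = exit_point Right"
      "pathfinish (snd (arms n)) = right_foot" "path_image (snd (arms n)) \<subseteq> approx n" for n
    using arms_join[of n] unfolding joins_def by blast+
  have within: "t \<in> {0..1} \<Longrightarrow> dist (fst (arms n) t) (fst (arms (Suc n)) t) \<le> 2 * (1/5) ^ n"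
    "t \<in> {0..1} \<Longrightarrow> dist (snd (arms n) t) (snd (arms (Suc n)) t) \<le> 2 * (1/5) ^ n" for n t
    using arms_within[of n] unfolding uniformly_within_def by blast+
  show "path_component fractal (exit_point Left) left_foot"
    unfolding fractal_def by (rule path_limit[OF l(1-3) within(1) M K approx_antimono l(4)])
  show "path_component fractal (exit_point Right) right_foot"
    unfolding fractal_def by (rule path_limit[OF r(1-3) within(2) M K approx_antimono r(4)])
qed

lemma path_component_spine:
  assumes "0 \<le> y" "y \<le> 1" "0 \<le> y'" "y' \<le> 1"
  shows "path_component fractal (3/4, y) (3/4, y')"
proof -
  have "path_image (linepath (3/4, y) (3/4, y')) \<subseteq> fractal"
    unfolding fractal_def
    by (rule INT_greatest) (rule joins_spine[OF assms, unfolded joins_def, THEN conjunct2, THEN conjunct1])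
  then show ?thesis
    unfolding path_component_def by (intro exI[of _ "linepath (3/4, y) (3/4, y')"]) simp
qed

text \<open>
  Every exit can be joined to the foot of the right arm, and a path between distinct points contains
  an arc.
\<close>

lemma arc_between_exits:
  assumes "d \<noteq> e"
  obtains g where "arc g" "path_image g \<subseteq> fractal" "pathstart g = exit_point d" "pathfinish g = exit_point e"
proof -
  have foot: "path_component fractal (exit_point d) right_foot" for d
  proof (cases d)
    case Left
    have "path_component fractal left_foot right_foot"
      unfolding left_foot_def right_foot_def by (rule path_component_spine) auto
    then show ?thesis
      unfolding Left by (rule path_component_trans[OF arms_limit(1)])
  next
    case Right
    then show ?thesis using arms_limit(2) by (simp only:)
  next
    case Top
    then show ?thesis
      unfolding right_foot_def Top exit_point.simps by (intro path_component_spine) auto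
  next
    case Bottom
    then show ?thesis
      unfolding right_foot_def Bottom exit_point.simps by (intro path_component_spine) auto
  qed
  have "path_component fractal (exit_point d) (exit_point e)"
    by (rule path_component_trans[OF foot path_component_sym[OF foot]])
  then obtain p where p: "path p" "path_image p \<subseteq> fractal"
      "pathstart p = exit_point d" "pathfinish p = exit_point e"
    unfolding path_component_def by blast
  moreover have "exit_point d \<noteq> exit_point e" using assms by (cases d; cases e) auto
  ultimately obtain g where "arc g" "path_image g \<subseteq> path_image p"
      "pathstart g = exit_point d" "pathfinish g = exit_point e"
    using path_contains_arc by metis
  then show thesis using that p(2) by (meson order_trans)
qed

section \<open>Lengths of arcs\<close>

definition arcs_between :: "point \<Rightarrow> point \<Rightarrow> (real \<Rightarrow> point) set" where
  "arcs_between x y =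
    {g. arc g \<and> path_image g \<subseteq> fractal \<and> pathstart g = x \<and> pathfinish g = y}"

text \<open>
  The infimum costs nothing, since all arcs between two points of the attractor have the same image;
  and it makes the estimates below independent of a choice of arcs. It is infinite if \<open>x = y\<close>, as an
  arc has distinct endpoints.
\<close>

definition inner_distance :: "point \<Rightarrow> point \<Rightarrow> ennreal" where
  "inner_distance x y = (INF g\<in>arcs_between x y. curve_length g)"

lemma arcs_between_unique:
  assumes "g \<in> arcs_between x y" "h \<in> arcs_between x y"
  shows "path_image g = path_image h"
proof (rule arc_unique_if_no_loop[of fractal])
  show "\<not> path_image c \<subseteq> fractal" if "simple_path c" "pathfinish c = pathstart c" for c
    using that by (rule fractal_no_simple_closed_curve)
qed (use assms in \<open>simp_all add: arcs_between_def\<close>)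

lemma dist_le_inner_distance: "ennreal (dist x y) \<le> inner_distance x y"
  unfolding inner_distance_def
proof (rule INF_greatest)
  fix g assume "g \<in> arcs_between x y"
  then have "g 0 = x" "g 1 = y" by (simp_all add: arcs_between_def pathstart_def pathfinish_def)
  then show "ennreal (dist x y) \<le> curve_length g" using dist_le_curve_length[of g] by simp
qed

lemma inner_distance_split:
  assumes cut: "\<And>S. connected S \<Longrightarrow> S \<subseteq> fractal \<Longrightarrow> x \<in> S \<Longrightarrow> y \<in> S \<Longrightarrow> p \<in> S"
    and ne: "x \<noteq> p" "p \<noteq> y"
  shows "inner_distance x p + inner_distance p y \<le> inner_distance x y"
  unfolding inner_distance_def[of x y]
proof (rule INF_greatest)
  fix g assume "g \<in> arcs_between x y"
  then have g: "arc g" "path_image g \<subseteq> fractal" "pathstart g = x" "pathfinish g = y"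
    by (simp_all add: arcs_between_def)
  have "p \<in> path_image g"
    using g pathstart_in_path_image[of g] pathfinish_in_path_image[of g]
    by (intro cut connected_arc_image) auto
  then obtain s where s: "s \<in> {0..1}" "p = g s" by (auto simp: path_image_def)
  have "s \<noteq> 0" "s \<noteq> 1" using ne s g by (auto simp: pathstart_def pathfinish_def)
  then have "arc (subpath 0 s g)" "arc (subpath s 1 g)"
    using arc_subpath_arc[OF g(1), of 0 s] arc_subpath_arc[OF g(1), of s 1] s by auto
  moreover have "path_image (subpath 0 s g) \<subseteq> fractal" "path_image (subpath s 1 g) \<subseteq> fractal"
    using path_image_subpath_subset[of 0 s g] path_image_subpath_subset[of s 1 g] s g(2) by auto
  ultimately have "subpath 0 s g \<in> arcs_between x p" "subpath s 1 g \<in> arcs_between p y"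
    using g s by (auto simp: arcs_between_def pathstart_def pathfinish_def subpath_def)
  then have "inner_distance x p + inner_distance p y
      \<le> curve_length (subpath 0 s g) + curve_length (subpath s 1 g)"
    unfolding inner_distance_def by (intro add_mono INF_lower)
  also have "\<dots> \<le> curve_length g" by (rule curve_length_subpaths[OF s(1)])
  finally show "inner_distance x p + inner_distance p y \<le> curve_length g" .
qed

definition exit_distance :: "side \<Rightarrow> side \<Rightarrow> ennreal" where
  "exit_distance d e = inner_distance (exit_point d) (exit_point e)"

lemma arc_zoom:
  assumes g: "arc g" "path_image g \<subseteq> fractal" and v: "v \<in> cells n"
  shows "arc (zoom n v \<circ> g)" and "path_image (zoom n v \<circ> g) \<subseteq> fractal"
proof -
  have "path (zoom n v \<circ> g)"
    using g(1) by (intro path_continuous_image arc_imp_path continuous_on_zoom)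
  moreover have "inj_on (zoom n v \<circ> g) {0..1}"
    using g(1) zoom_eq_iff by (intro comp_inj_on) (auto simp: arc_def inj_on_def)
  ultimately show "arc (zoom n v \<circ> g)" by (simp only: arc_def)
  show "path_image (zoom n v \<circ> g) \<subseteq> fractal"
    unfolding path_image_compose using g(2) zoom_fractal[OF v] by blast
qed

text \<open>
  By uniqueness, an arc between two exits of a white square is the small copy of an arc between the
  exits of the unit square; it cannot leave the square.
\<close>

lemma exit_distance_zoom:
  assumes w: "w \<in> white" and "d \<noteq> e"
    and x: "zoom 1 w (exit_point d) = x" and y: "zoom 1 w (exit_point e) = y"
  shows "ennreal (1/5) * exit_distance d e \<le> inner_distance x y"
  unfolding inner_distance_def
proof (rule INF_greatest)
  fix g assume g: "g \<in> arcs_between x y"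
  obtain h where h: "arc h" "path_image h \<subseteq> fractal"
      "pathstart h = exit_point d" "pathfinish h = exit_point e"
    using arc_between_exits[OF \<open>d \<noteq> e\<close>] .
  have zh: "zoom 1 w \<circ> h \<in> arcs_between x y"
    using arc_zoom[OF h(1,2) w[unfolded white_cells]] h(3,4) x y
    by (simp add: arcs_between_def pathstart_compose pathfinish_compose)
  have "exit_distance d e \<le> curve_length h"
    unfolding exit_distance_def inner_distance_def
    by (rule INF_lower) (use h in \<open>simp add: arcs_between_def\<close>)
  then have "ennreal (1/5) * exit_distance d e \<le> ennreal (1/5) * curve_length h"
    by (rule mult_left_mono) simp
  also have "\<dots> = curve_length (zoom 1 w \<circ> h)"
    by (rule curve_length_scale[symmetric]) (auto simp: dist_zoom)
  also have "\<dots> \<le> curve_length g"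
    using g zh arcs_between_unique[OF g zh] by (intro curve_length_arc_le) (auto simp: arcs_between_def)
  finally show "ennreal (1/5) * exit_distance d e \<le> curve_length g" .
qed

definition copies :: "(nat \<times> nat) set \<Rightarrow> point set" where
  "copies V = (\<Union>v\<in>V. zoom 1 v ` fractal)"

lemma exit_in_copies:
  assumes "v \<in> V" "zoom 1 v (exit_point d) = x"
  shows "x \<in> copies V"
proof -
  have "x \<in> zoom 1 v ` fractal"
    unfolding assms(2)[symmetric] by (rule imageI) (rule exit_point_fractal)
  then show ?thesis using assms(1) unfolding copies_def by (rule UN_I[rotated])
qed

text \<open>
  The white squares in \<open>V\<close> and the others are joined at \<open>p\<close> only.
\<close>

definition cut_at :: "(nat \<times> nat) set \<Rightarrow> point \<Rightarrow> bool" where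
  "cut_at V p \<longleftrightarrow> V \<subseteq> white \<and> copies V \<inter> copies (white - V) \<subseteq> {p}"

lemma cut_atI:
  assumes "V \<subseteq> white"
    and "\<And>i j k l. (i, j) \<in> V \<Longrightarrow> (k, l) \<in> white \<Longrightarrow> (k, l) \<notin> V \<Longrightarrow>
      (k = Suc i \<and> l = j \<longrightarrow> zoom 1 (i, j) (exit_point Right) = p) \<and>
      (i = Suc k \<and> l = j \<longrightarrow> zoom 1 (i, j) (exit_point Left) = p) \<and>
      (k = i \<and> l = Suc j \<longrightarrow> zoom 1 (i, j) (exit_point Top) = p) \<and>
      (k = i \<and> j = Suc l \<longrightarrow> zoom 1 (i, j) (exit_point Bottom) = p)"
  shows "cut_at V p"
  unfolding cut_at_def copies_def
proof (intro conjI assms(1) subsetI)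
  fix x assume "x \<in> (\<Union>v\<in>V. zoom 1 v ` fractal) \<inter> (\<Union>v\<in>white - V. zoom 1 v ` fractal)"
  then obtain u v where uv: "u \<in> V" "v \<in> white" "v \<notin> V" "x \<in> zoom 1 u ` fractal" "x \<in> zoom 1 v ` fractal"
    by blast
  obtain i j k l where eq: "u = (i, j)" "v = (k, l)" by fastforce
  note * = uv[unfolded eq]
  from * have "(i, j) \<noteq> (k, l)" by metis
  from copies_meet[OF *(4,5) this] assms(2)[OF *(1-3)] show "x \<in> {p}"
    by (elim disjE) simp_all
qed

lemma inner_distance_cut:
  assumes "cut_at V p" and x: "x \<in> copies V" "x \<noteq> p" and y: "y \<in> copies (white - V)" "p \<noteq> y"
  shows "inner_distance x p + inner_distance p y \<le> inner_distance x y"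
proof (rule inner_distance_split)
  fix S assume S: "connected S" "S \<subseteq> fractal" "x \<in> S" "y \<in> S"
  have closed: "closed (copies U)" if "U \<subseteq> white" for U
    unfolding copies_def using finite_subset[OF that finite_white]
    by (intro closed_UN ballI compact_imp_closed compact_continuous_image continuous_on_zoom compact_fractal)
  have V: "V \<subseteq> white" "copies V \<inter> copies (white - V) \<subseteq> {p}" using assms(1) by (simp_all add: cut_at_def)
  have "copies V \<union> copies (white - V) = copies white"
    unfolding copies_def UN_Un[symmetric] using V(1) by (simp only: Un_Diff_cancel sup.absorb2)
  then have sub: "S \<subseteq> copies V \<union> copies (white - V)"
    using S(2) fractal_self_similar by (simp only: copies_def)
  have "closed (copies V)" "closed (copies (white - V))"
    using V(1) by (simp_all add: closed)
  moreover have "copies V \<inter> S \<noteq> {}" "copies (white - V) \<inter> S \<noteq> {}"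
    using S x(1) y(1) by blast+
  ultimately have "copies V \<inter> copies (white - V) \<inter> S \<noteq> {}"
    using S(1) sub unfolding connected_closed by metis
  then show "p \<in> S" using V(2) by blast
qed (fact x(2) y(2))+

text \<open>
  The points through which arcs between the exits must pass. The first four lie on the left arm;
  then come the common points of (3,2) and (3,3), of (3,3) and (3,4), of (3,1) and (3,2), and of
  (3,2) and (4,2).
\<close>

lemma cuts:
  "cut_at {(0, 2)} (1/5, 1/2)"
  "cut_at {(0, 2), (1, 2)} (7/20, 3/5)"
  "cut_at {(0, 2), (1, 2), (1, 3)} (2/5, 7/10)"
  "cut_at {(0, 2), (1, 2), (1, 3), (2, 3)} (3/5, 7/10)"
  "cut_at {(0, 2), (1, 2), (1, 3), (2, 3), (3, 3), (3, 4)} (3/4, 3/5)"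
  "cut_at {(0, 2), (1, 2), (1, 3), (2, 3), (4, 2), (3, 0), (3, 1), (3, 2), (3, 3)} (3/4, 4/5)"
  "cut_at {(3, 0), (3, 1)} (3/4, 2/5)"
  "cut_at {(0, 2), (1, 2), (1, 3), (2, 3), (3, 0), (3, 1), (3, 2), (3, 3), (3, 4)} (4/5, 1/2)"
  by (rule cut_atI, simp add: white_def,
      simp only: white_def insert_iff empty_iff prod.inject, elim disjE conjE; simp add: zoom_def)+

text \<open>
  An arc that leaves \<open>V\<close> through the last square \<open>w\<close>, which it crosses from side \<open>d\<close> to side \<open>e\<close>. The
  bound \<open>L\<close> for the rest of the arc is supplied by the next step.
\<close>

lemma exit_distance_step:
  assumes cut: "cut_at V p" and w: "w \<in> V" and "d \<noteq> e"
    and x: "zoom 1 w (exit_point d) = x" and p: "zoom 1 w (exit_point e) = p"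
    and y: "y \<in> copies (white - V)" "p \<noteq> y" and L: "L \<le> inner_distance p y"
  shows "ennreal (1/5) * exit_distance d e + L \<le> inner_distance x y"
proof -
  have "exit_point d \<noteq> exit_point e" using \<open>d \<noteq> e\<close> by (cases d; cases e) auto
  then have "x \<noteq> p" using x p zoom_eq_iff by metis
  have "w \<in> white" using cut w unfolding cut_at_def by blast
  then have "ennreal (1/5) * exit_distance d e + L \<le> inner_distance x p + inner_distance p y"
    using exit_distance_zoom[OF _ \<open>d \<noteq> e\<close> x p] L by (intro add_mono)
  also have "\<dots> \<le> inner_distance x y"
    using cut exit_in_copies[OF w x] \<open>x \<noteq> p\<close> y by (rule inner_distance_cut)
  finally show ?thesis .
qed

text \<open>
  Any arc from the left exit to a point beyond the arm crosses its four squares in the same way. The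
  condition on \<open>fst y\<close> only keeps \<open>y\<close> away from the four cut points.
\<close>

lemma left_arm_distance:
  assumes y: "y \<in> copies (white - {(0, 2), (1, 2), (1, 3), (2, 3)})" "3/4 \<le> fst y"
    and L: "L \<le> inner_distance (3/5, 7/10) y"
  shows "ennreal (1/5) * exit_distance Left Right + (ennreal (1/5) * exit_distance Left Top +
    (ennreal (1/5) * exit_distance Bottom Right + (ennreal (1/5) * exit_distance Left Right + L)))
    \<le> inner_distance (exit_point Left) y"
proof -
  have far: "y \<in> copies (white - V)" if "V \<subseteq> {(0, 2), (1, 2), (1, 3), (2, 3)}" for V
    using y(1) that unfolding copies_def by blast
  have ne: "(a, b) \<noteq> y" if "a < 3/4" for a b using y(2) that by auto
  let ?L4 = "ennreal (1/5) * exit_distance Left Right + L"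
  let ?L3 = "ennreal (1/5) * exit_distance Bottom Right + ?L4"
  let ?L2 = "ennreal (1/5) * exit_distance Left Top + ?L3"
  have L4: "?L4 \<le> inner_distance (2/5, 7/10) y"
    by (rule exit_distance_step[OF cuts(4) _ _ _ _ far ne L, where w = "(2, 3)"])
       (simp_all add: zoom_def)
  have L3: "?L3 \<le> inner_distance (7/20, 3/5) y"
    by (rule exit_distance_step[OF cuts(3) _ _ _ _ far ne L4, where w = "(1, 3)"])
       (simp_all add: zoom_def)
  have L2: "?L2 \<le> inner_distance (1/5, 1/2) y"
    by (rule exit_distance_step[OF cuts(2) _ _ _ _ far ne L3, where w = "(1, 2)"])
       (simp_all add: zoom_def)
  show ?thesis
    by (rule exit_distance_step[OF cuts(1) _ _ _ _ far ne L2, where w = "(0, 2)"])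
       (simp_all add: zoom_def)
qed

lemma right_arm_distance:
  assumes "d \<in> {Top, Bottom}"
  shows "ennreal (1/5) * exit_distance d Right + ennreal (1/5) * exit_distance Left Right
    \<le> inner_distance (zoom 1 (3, 2) (exit_point d)) (exit_point Right)"
proof (rule exit_distance_step[OF cuts(8), where w = "(3, 2)"])
  show "ennreal (1/5) * exit_distance Left Right \<le> inner_distance (4/5, 1/2) (exit_point Right)"
    by (rule exit_distance_zoom[where w = "(4, 2)"]) (auto simp: white_def zoom_def)
  show "exit_point Right \<in>
      copies (white - {(0, 2), (1, 2), (1, 3), (2, 3), (3, 0), (3, 1), (3, 2), (3, 3), (3, 4)})"
    by (rule exit_in_copies[where v = "(4, 2)" and d = Right]) (simp_all add: white_def zoom_def)
qed (use assms in \<open>auto simp: zoom_def\<close>)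

lemma exit_distance_Left_Right:
  "ennreal (1/5) * exit_distance Left Right + (ennreal (1/5) * exit_distance Left Top +
    (ennreal (1/5) * exit_distance Bottom Right + (ennreal (1/5) * exit_distance Left Right +
    (ennreal (1/5) * exit_distance Left Bottom + (ennreal (1/5) * exit_distance Top Right +
     ennreal (1/5) * exit_distance Left Right))))) \<le> exit_distance Left Right"
proof -
  have "ennreal (1/5) * exit_distance Left Bottom + (ennreal (1/5) * exit_distance Top Right +
      ennreal (1/5) * exit_distance Left Right) \<le> inner_distance (3/5, 7/10) (exit_point Right)"
  proof (rule exit_distance_step[OF cuts(5), where w = "(3, 3)"])
    show "ennreal (1/5) * exit_distance Top Right + ennreal (1/5) * exit_distance Left Right
        \<le> inner_distance (3/4, 3/5) (exit_point Right)"
      using right_arm_distance[of Top] by (simp add: zoom_def)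
    show "exit_point Right \<in> copies (white - {(0, 2), (1, 2), (1, 3), (2, 3), (3, 3), (3, 4)})"
      by (rule exit_in_copies[where v = "(4, 2)" and d = Right]) (simp_all add: white_def zoom_def)
  qed (simp_all add: zoom_def)
  moreover have "exit_point Right \<in> copies (white - {(0, 2), (1, 2), (1, 3), (2, 3)})"
    by (rule exit_in_copies[where v = "(4, 2)" and d = Right]) (simp_all add: white_def zoom_def)
  ultimately show ?thesis
    unfolding exit_distance_def[of Left Right] by (intro left_arm_distance[unfolded exit_distance_def[of Left Right]]) simp_all
qed

text \<open>
  The part of the arc in the square (3,4) is left out of the estimate. Likewise, the parts in the
  column below (3,3) and above (3,2) are left out in the next two lemmas.
\<close>

lemma exit_distance_Left_Top:
  "ennreal (1/5) * exit_distance Left Right + (ennreal (1/5) * exit_distance Left Top +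
    (ennreal (1/5) * exit_distance Bottom Right + (ennreal (1/5) * exit_distance Left Right +
     ennreal (1/5) * exit_distance Left Top))) \<le> exit_distance Left Top"
proof -
  have "ennreal (1/5) * exit_distance Left Top + 0 \<le> inner_distance (3/5, 7/10) (exit_point Top)"
  proof (rule exit_distance_step[OF cuts(6), where w = "(3, 3)"])
    show "exit_point Top \<in>
        copies (white - {(0, 2), (1, 2), (1, 3), (2, 3), (4, 2), (3, 0), (3, 1), (3, 2), (3, 3)})"
      by (rule exit_in_copies[where v = "(3, 4)" and d = Top]) (simp_all add: white_def zoom_def)
  qed (simp_all add: zoom_def)
  moreover have "exit_point Top \<in> copies (white - {(0, 2), (1, 2), (1, 3), (2, 3)})"
    by (rule exit_in_copies[where v = "(3, 4)" and d = Top]) (simp_all add: white_def zoom_def)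
  ultimately show ?thesis
    unfolding exit_distance_def[of Left Top] add_0_right
    by (intro left_arm_distance[unfolded exit_distance_def[of Left Top]]) simp_all
qed

lemma exit_distance_Left_Bottom:
  "ennreal (1/5) * exit_distance Left Right + (ennreal (1/5) * exit_distance Left Top +
    (ennreal (1/5) * exit_distance Bottom Right + (ennreal (1/5) * exit_distance Left Right +
     ennreal (1/5) * exit_distance Left Bottom))) \<le> exit_distance Left Bottom"
proof -
  have "ennreal (1/5) * exit_distance Left Bottom + 0 \<le> inner_distance (3/5, 7/10) (exit_point Bottom)"
  proof (rule exit_distance_step[OF cuts(5), where w = "(3, 3)"])
    show "exit_point Bottom \<in> copies (white - {(0, 2), (1, 2), (1, 3), (2, 3), (3, 3), (3, 4)})"
      by (rule exit_in_copies[where v = "(3, 0)" and d = Bottom]) (simp_all add: white_def zoom_def)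
  qed (simp_all add: zoom_def)
  moreover have "exit_point Bottom \<in> copies (white - {(0, 2), (1, 2), (1, 3), (2, 3)})"
    by (rule exit_in_copies[where v = "(3, 0)" and d = Bottom]) (simp_all add: white_def zoom_def)
  ultimately show ?thesis
    unfolding exit_distance_def[of Left Bottom] add_0_right
    by (intro left_arm_distance[unfolded exit_distance_def[of Left Bottom]]) simp_all
qed

lemma exit_distance_Top_Right:
  "ennreal (1/5) * exit_distance Top Right + ennreal (1/5) * exit_distance Left Right
    \<le> exit_distance Top Right"
proof -
  have "inner_distance (exit_point Top) (3/4, 3/5) + inner_distance (3/4, 3/5) (exit_point Right)
      \<le> exit_distance Top Right"
    unfolding exit_distance_def
  proof (rule inner_distance_cut[OF cuts(5)])
    show "exit_point Top \<in> copies {(0, 2), (1, 2), (1, 3), (2, 3), (3, 3), (3, 4)}"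
      by (rule exit_in_copies[where v = "(3, 4)" and d = Top]) (simp_all add: zoom_def)
    show "exit_point Right \<in> copies (white - {(0, 2), (1, 2), (1, 3), (2, 3), (3, 3), (3, 4)})"
      by (rule exit_in_copies[where v = "(4, 2)" and d = Right]) (simp_all add: white_def zoom_def)
  qed simp_all
  moreover have "ennreal (1/5) * exit_distance Top Right + ennreal (1/5) * exit_distance Left Right
      \<le> inner_distance (3/4, 3/5) (exit_point Right)"
    using right_arm_distance[of Top] by (simp add: zoom_def)
  ultimately show ?thesis
    by (meson add_increasing order_trans zero_le)
qed

text \<open>
  The summand 2/5 is the height of the squares (3,0) and (3,1). It is the inhomogeneous term that
  forces the lengths to be infinite.
\<close>

lemma exit_distance_Bottom_Right:
  "ennreal (2/5) + (ennreal (1/5) * exit_distance Bottom Right + ennreal (1/5) * exit_distance Left Right)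
    \<le> exit_distance Bottom Right"
proof -
  have "inner_distance (exit_point Bottom) (3/4, 2/5) + inner_distance (3/4, 2/5) (exit_point Right)
      \<le> exit_distance Bottom Right"
    unfolding exit_distance_def
  proof (rule inner_distance_cut[OF cuts(7)])
    show "exit_point Bottom \<in> copies {(3, 0), (3, 1)}"
      by (rule exit_in_copies[where v = "(3, 0)" and d = Bottom]) (simp_all add: zoom_def)
    show "exit_point Right \<in> copies (white - {(3, 0), (3, 1)})"
      by (rule exit_in_copies[where v = "(4, 2)" and d = Right]) (simp_all add: white_def zoom_def)
  qed simp_all
  moreover have "ennreal (1/5) * exit_distance Bottom Right + ennreal (1/5) * exit_distance Left Right
      \<le> inner_distance (3/4, 2/5) (exit_point Right)"
    using right_arm_distance[of Bottom] by (simp add: zoom_def)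
  moreover have "ennreal (2/5) \<le> inner_distance (exit_point Bottom) (3/4, 2/5)"
    using dist_le_inner_distance[of "exit_point Bottom" "(3/4, 2/5)"] by (simp add: dist_Pair_Pair dist_real_def)
  ultimately show ?thesis
    by (meson add_mono order_trans)
qed

lemma exit_distance_Left_Right_infinite: "exit_distance Left Right = \<infinity>"
proof (rule ccontr)
  assume "exit_distance Left Right \<noteq> \<infinity>"
  then have "exit_distance Left Right < top" by (simp add: less_top)
  from le_less_trans[OF exit_distance_Left_Right this]
  have "exit_distance Left Right < top" "exit_distance Left Top < top" "exit_distance Bottom Right < top"
    "exit_distance Left Bottom < top" "exit_distance Top Right < top"
    by (auto simp: ennreal_mult_less_top)
  then obtain h lt br lb tr :: real where nn: "0 \<le> h" "0 \<le> lt" "0 \<le> br" "0 \<le> lb" "0 \<le> tr"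
    and eq: "exit_distance Left Right = ennreal h" "exit_distance Left Top = ennreal lt"
      "exit_distance Bottom Right = ennreal br" "exit_distance Left Bottom = ennreal lb"
      "exit_distance Top Right = ennreal tr"
    unfolding less_top_ennreal by blast
  have *: "ennreal (1/5) * ennreal x = ennreal (x / 5)" if "0 \<le> x" for x
    using that by (simp flip: ennreal_mult)
  have "h/5 + (lt/5 + (br/5 + (h/5 + (lb/5 + (tr/5 + h/5))))) \<le> h"
    using exit_distance_Left_Right nn by (simp add: eq * del: ennreal_plus flip: ennreal_plus)
  moreover have "h/5 + (lt/5 + (br/5 + (h/5 + lt/5))) \<le> lt"
    using exit_distance_Left_Top nn by (simp add: eq * del: ennreal_plus flip: ennreal_plus)
  moreover have "h/5 + (lt/5 + (br/5 + (h/5 + lb/5))) \<le> lb"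
    using exit_distance_Left_Bottom nn by (simp add: eq * del: ennreal_plus flip: ennreal_plus)
  moreover have "tr/5 + h/5 \<le> tr"
    using exit_distance_Top_Right nn by (simp add: eq * del: ennreal_plus flip: ennreal_plus)
  moreover have "2/5 + (br/5 + h/5) \<le> br"
    using exit_distance_Bottom_Right nn by (simp add: eq * del: ennreal_plus flip: ennreal_plus)
  \<comment> \<open>Weights 12, 5, 3, 3, 5, in the order of the inequalities, cancel all variables.\<close>
  ultimately show False by linarith
qed

lemma exit_distance_infinite:
  "exit_distance Left Top = \<infinity>" "exit_distance Left Bottom = \<infinity>"
  "exit_distance Top Right = \<infinity>" "exit_distance Bottom Right = \<infinity>"
proof -
  have H: "ennreal (1/5) * exit_distance Left Right = \<infinity>"
    unfolding exit_distance_Left_Right_infinite by (simp add: ennreal_mult_top)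
  show "exit_distance Left Top = \<infinity>"
    using exit_distance_Left_Top unfolding H by (simp add: top_unique)
  show "exit_distance Left Bottom = \<infinity>"
    using exit_distance_Left_Bottom unfolding H by (simp add: top_unique)
  show "exit_distance Top Right = \<infinity>"
    using exit_distance_Top_Right unfolding H by (simp add: top_unique)
  show "exit_distance Bottom Right = \<infinity>"
    using exit_distance_Bottom_Right unfolding H by (simp add: top_unique)
qed

section \<open>Trees\<close>

text \<open>
  A vertex of maximal rank on a cycle would have two neighbours of smaller rank.
\<close>

lemma tree_graphI:
  fixes V :: "'v set" and rank :: "'v \<Rightarrow> nat"
  assumes root: "r \<in> V"
    and down: "\<And>v. v \<in> V \<Longrightarrow> v \<noteq> r \<Longrightarrow> \<exists>u\<in>V. {u, v} \<in> E \<and> rank u < rank v"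
    and uniq: "\<And>u u' v. u \<in> V \<Longrightarrow> u' \<in> V \<Longrightarrow> v \<in> V \<Longrightarrow> {u, v} \<in> E \<Longrightarrow> {u', v} \<in> E \<Longrightarrow>
      rank u < rank v \<Longrightarrow> rank u' < rank v \<Longrightarrow> u = u'"
    and neq: "\<And>u v. u \<in> V \<Longrightarrow> v \<in> V \<Longrightarrow> {u, v} \<in> E \<Longrightarrow> rank u \<noteq> rank v"
  shows "tree_graph V E"
proof -
  define R where "R = {(x, y). {x, y} \<in> E}"
  have to_root: "(v, r) \<in> R\<^sup>*" if "v \<in> V" for v
    using that
  proof (induction "rank v" arbitrary: v rule: less_induct)
    case less
    show ?case
    proof (cases "v = r")
      case False
      then obtain u where u: "u \<in> V" "{u, v} \<in> E" "rank u < rank v" using down less.prems by blast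
      then have "(v, u) \<in> R" by (simp add: R_def insert_commute)
      then show ?thesis using less.hyps[OF u(3,1)] by (rule converse_rtrancl_into_rtrancl)
    qed simp
  qed
  have "sym R" by (auto simp: R_def sym_def insert_commute)
  then have "sym (R\<^sup>*)" by (rule sym_rtrancl)
  then have conn: "(u, v) \<in> R\<^sup>*" if "u \<in> V" "v \<in> V" for u v
    using to_root[OF that(1)] to_root[OF that(2)] by (meson rtrancl_trans symD)
  have no_cycle: False
    if c: "length c \<ge> 3" "distinct c" "set c \<subseteq> V"
      "successively (\<lambda>x y. {x, y} \<in> E) c" "{last c, hd c} \<in> E" for c
  proof -
    have "c \<noteq> []" using c(1) by auto
    then obtain v where v: "v \<in> set c" "\<And>u. u \<in> set c \<Longrightarrow> rank u \<le> rank v"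
      using arg_max_nat_lemma[of "\<lambda>u. u \<in> set c" "hd c" rank "Suc (Max (rank ` set c))"]
      by (metis List.finite_set Max_ge finite_imageI hd_in_set imageI less_Suc_eq_le)
    then obtain i where i: "i < length c" "v = c ! i" by (metis in_set_conv_nth)
    have step: "{c ! k, c ! Suc k} \<in> E" if "Suc k < length c" for k
      using c(4) that by (simp add: successively_conv_nth)
    have close: "{c ! (length c - 1), c ! 0} \<in> E"
      using c(5) \<open>c \<noteq> []\<close> by (simp add: last_conv_nth hd_conv_nth)
    have "\<exists>j k. j < length c \<and> k < length c \<and> j \<noteq> k \<and> {c ! j, v} \<in> E \<and> {c ! k, v} \<in> E"
    proof -
      consider "i = 0" | "i = length c - 1" "i \<noteq> 0" | "0 < i" "Suc i < length c" using i(1) by linarith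
      then show ?thesis
      proof cases
        case 1
        then show ?thesis using c(1) i step[of 0] close
          by (intro exI[of _ "length c - 1"] exI[of _ 1]) (auto simp: insert_commute)
      next
        case 2
        obtain k where "i = Suc k" using \<open>i \<noteq> 0\<close> not0_implies_Suc by blast
        then have "{c ! (i - 1), c ! i} \<in> E" using step[of k] i(1) by simp
        then show ?thesis using c(1) i close \<open>i = length c - 1\<close>
          by (intro exI[of _ "i - 1"] exI[of _ 0]) (auto simp: insert_commute)
      next
        case 3
        then show ?thesis using c(1) i step[of "i - 1"] step[of i]
          by (intro exI[of _ "i - 1"] exI[of _ "Suc i"]) (auto simp: insert_commute)
      qed
    qed
    then obtain j k where jk: "j < length c" "k < length c" "j \<noteq> k" "{c ! j, v} \<in> E" "{c ! k, v} \<in> E"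
      by blast
    have low: "c ! l \<in> V \<and> rank (c ! l) < rank v" if "l < length c" "{c ! l, v} \<in> E" for l
    proof -
      have "c ! l \<in> set c" using that(1) by simp
      then show ?thesis using v c(3) neq[OF _ _ that(2)] by (metis le_neq_implies_less subsetD)
    qed
    have "c ! j = c ! k"
      by (rule uniq[OF _ _ _ jk(4,5)]) (use low jk v(1) c(3) in auto)
    then show False using jk c(2) by (simp add: nth_eq_iff_index_eq)
  qed
  show ?thesis
    unfolding tree_graph_def R_def[symmetric] using root conn no_cycle by blast
qed

section \<open>The pattern and its white squares\<close>

definition cell :: "nat \<Rightarrow> nat \<times> nat \<Rightarrow> point set" where
  "cell n v = zoom n v ` unit_square"

definition the_pattern :: "point set set" where
  "the_pattern = cell 1 ` white"

lemma cell_box: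
  "cell n (i, j) = {real i / 5 ^ n .. (real i + 1) / 5 ^ n} \<times> {real j / 5 ^ n .. (real j + 1) / 5 ^ n}"
proof (intro equalityI subsetI)
  fix p assume "p \<in> cell n (i, j)"
  then show "p \<in> {real i / 5 ^ n .. (real i + 1) / 5 ^ n} \<times> {real j / 5 ^ n .. (real j + 1) / 5 ^ n}"
    by (auto simp: cell_def zoom_def unit_square_def divide_right_mono)
next
  fix p assume p: "p \<in> {real i / 5 ^ n .. (real i + 1) / 5 ^ n} \<times> {real j / 5 ^ n .. (real j + 1) / 5 ^ n}"
  then have "(5 ^ n * fst p - real i, 5 ^ n * snd p - real j) \<in> unit_square"
    by (auto simp: unit_square_def field_simps)
  moreover have "p = zoom n (i, j) (5 ^ n * fst p - real i, 5 ^ n * snd p - real j)"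
    by (simp add: zoom_def)
  ultimately show "p \<in> cell n (i, j)" unfolding cell_def by (rule rev_image_eqI)
qed

lemma grid_square_eq_cell: "grid_square i j (5 ^ n) = cell n (i, j)"
  unfolding cell_box grid_square_def by auto

lemma square_eq_iff:
  assumes "q > 0" "q' > 0"
  shows "square x y q = square x' y' q' \<longleftrightarrow> x = x' \<and> y = y' \<and> q = q'"
  unfolding square_def times_eq_iff Icc_eq_Icc using assms by auto

lemma cell_eq_square: "cell n (i, j) = square (real i / 5 ^ n) (real j / 5 ^ n) (1 / 5 ^ n)"
  unfolding cell_box square_def by (simp add: add_divide_distrib)

lemma cell_inj: "cell n v = cell n w \<longleftrightarrow> v = w"
  by (cases v; cases w) (simp add: cell_eq_square square_eq_iff)

lemma white_squares_eq:
  "n \<ge> 1 \<Longrightarrow> white_squares (\<lambda>_. the_pattern) n = cell n ` cells n"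
proof (induction n rule: nat_induct_at_least)
  case base
  show ?case unfolding the_pattern_def white_cells by simp
next
  case (Suc n)
  then obtain k where n: "n = Suc k" by (cases n) auto
  have place: "place (real i / 5 ^ n) (real j / 5 ^ n) (1 / 5 ^ n) ` cell 1 w = cell (Suc n) (refine (i, j) w)"
    for i j w
    by (auto simp: cell_def image_image zoom_refine place_def zoom_def[of n] field_simps del: One_nat_def
        intro!: image_cong)
  have sq: "q > 0 \<and> square x y q \<in> cell n ` cells n \<longleftrightarrow>
      (\<exists>i j. (i, j) \<in> cells n \<and> x = real i / 5 ^ n \<and> y = real j / 5 ^ n \<and> q = 1 / 5 ^ n)" for x y q
  proof
    assume "q > 0 \<and> square x y q \<in> cell n ` cells n"
    then show "\<exists>i j. (i, j) \<in> cells n \<and> x = real i / 5 ^ n \<and> y = real j / 5 ^ n \<and> q = 1 / 5 ^ n"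
      by (auto simp: cell_eq_square square_eq_iff)
  next
    assume "\<exists>i j. (i, j) \<in> cells n \<and> x = real i / 5 ^ n \<and> y = real j / 5 ^ n \<and> q = 1 / 5 ^ n"
    then show "q > 0 \<and> square x y q \<in> cell n ` cells n"
      by (auto simp: cell_eq_square[symmetric])
  qed
  have "white_squares (\<lambda>_. the_pattern) (Suc n) =
      {place x y q ` W | x y q W. W \<in> the_pattern \<and> (q > 0 \<and> square x y q \<in> cell n ` cells n)}"
    unfolding n white_squares.simps Suc.IH[unfolded n] by blast
  also have "\<dots> = {place (real i / 5 ^ n) (real j / 5 ^ n) (1 / 5 ^ n) ` cell 1 w | i j w.
      (i, j) \<in> cells n \<and> w \<in> white}"
    unfolding sq the_pattern_def by blast
  also have "\<dots> = {cell (Suc n) (refine v w) | v w. v \<in> cells n \<and> w \<in> white}"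
    unfolding place by (simp add: split_paired_Ex)
  also have "\<dots> = cell (Suc n) ` cells (Suc n)"
    unfolding cells.simps by blast
  finally show ?case .
qed

lemma limit_set_eq_fractal: "limit_set (\<lambda>_. the_pattern) = fractal"
proof -
  have "\<Union> (white_squares (\<lambda>_. the_pattern) n) = approx n" if "n \<ge> 1" for n
    unfolding white_squares_eq[OF that] approx_def cell_def by blast
  then have "limit_set (\<lambda>_. the_pattern) = (\<Inter>n\<in>{1..}. approx n)"
    unfolding limit_set_def by auto
  also have "\<dots> = fractal"
  proof (intro equalityI subsetI)
    fix x assume x: "x \<in> (\<Inter>n\<in>{1..}. approx n)"
    then have "x \<in> approx (Suc n)" for n by auto
    then have "x \<in> approx n" for n using approx_Suc_subset[of n] by (rule subsetD[rotated])
    then show "x \<in> fractal" by (simp add: fractal_def)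
  qed (simp add: fractal_def)
  finally show ?thesis .
qed

text \<open>
  The digits of the exits in base 5 are constant: all 2 for the row of the left and right exits, all 3
  for the column of the top and bottom exits.
\<close>

primrec mid_row :: "nat \<Rightarrow> nat" where
  "mid_row 0 = 0"
| "mid_row (Suc n) = 5 * mid_row n + 2"

primrec spine_column :: "nat \<Rightarrow> nat" where
  "spine_column 0 = 0"
| "spine_column (Suc n) = 5 * spine_column n + 3"

lemma mid_row: "2 * mid_row n + 1 = 5 ^ n"
  by (induction n) auto

lemma spine_column: "4 * spine_column n + 3 = 3 * 5 ^ n"
  by (induction n) auto

lemma in_cells_Suc:
  "(i, j) \<in> cells (Suc n) \<longleftrightarrow> (\<exists>k l a b. (k, l) \<in> cells n \<and> (a, b) \<in> white \<and> i = 5 * k + a \<and> j = 5 * l + b)"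
  unfolding cells.simps UN_iff image_iff Bex_def split_paired_Ex refine.simps prod.inject by blast

lemma cells_left: "(0, j) \<in> cells n \<longleftrightarrow> j = mid_row n"
proof (induction n arbitrary: j)
  case (Suc n)
  show ?case unfolding in_cells_Suc using Suc by (auto simp: white_def)
qed simp

lemma cells_bottom: "(i, 0) \<in> cells n \<longleftrightarrow> i = spine_column n"
proof (induction n arbitrary: i)
  case (Suc n)
  show ?case unfolding in_cells_Suc using Suc by (auto simp: white_def)
qed simp

lemma last_digit:
  fixes k a :: nat
  assumes "k < 5 ^ n" "a \<le> 4"
  shows "5 ^ Suc n - 1 = 5 * k + a \<longleftrightarrow> k = 5 ^ n - 1 \<and> a = 4"
proof -
  obtain p where "5 ^ n = Suc p" using not0_implies_Suc[of "5 ^ n"] by auto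
  then show ?thesis using assms(2) by simp presburger
qed

lemma cells_right: "(5 ^ n - 1, j) \<in> cells n \<longleftrightarrow> j = mid_row n"
proof (induction n arbitrary: j)
  case (Suc n)
  have "(5 ^ Suc n - 1, j) \<in> cells (Suc n) \<longleftrightarrow>
      (\<exists>l b. (5 ^ n - 1, l) \<in> cells n \<and> (4, b) \<in> white \<and> j = 5 * l + b)"
    unfolding in_cells_Suc using last_digit cells_bound white_bound by (metis (no_types))
  then show ?case using Suc by (auto simp: white_def)
qed simp

lemma cells_top: "(i, 5 ^ n - 1) \<in> cells n \<longleftrightarrow> i = spine_column n"
proof (induction n arbitrary: i)
  case (Suc n)
  have "(i, 5 ^ Suc n - 1) \<in> cells (Suc n) \<longleftrightarrow>
      (\<exists>k a. (k, 5 ^ n - 1) \<in> cells n \<and> (a, 4) \<in> white \<and> i = 5 * k + a)"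
    unfolding in_cells_Suc using last_digit cells_bound white_bound by (metis (no_types))
  then show ?case using Suc by (auto simp: white_def)
qed simp

primrec exit_cell :: "side \<Rightarrow> nat \<Rightarrow> nat \<times> nat" where
  "exit_cell Left n = (0, mid_row n)"
| "exit_cell Right n = (5 ^ n - 1, mid_row n)"
| "exit_cell Top n = (spine_column n, 5 ^ n - 1)"
| "exit_cell Bottom n = (spine_column n, 0)"

lemma cell_mem: "cell n v \<in> cell n ` cells n \<longleftrightarrow> v \<in> cells n"
  by (auto simp: cell_inj)

text \<open>
  In each row and column at the border of the grid there is exactly one white square, and opposite
  ones match.
\<close>

lemma is_exit_iff: "is_exit d (5 ^ n) (cell n ` cells n) S \<longleftrightarrow> S = cell n (exit_cell d n)"
proof -
  have lt: "mid_row n < 5 ^ n" "spine_column n < 5 ^ n"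
    using mid_row[of n] spine_column[of n] by linarith+
  show ?thesis
    by (cases d)
       (simp_all only: is_exit.simps grid_square_eq_cell cell_mem cells_left cells_right cells_top
          cells_bottom exit_cell.simps, use lt in \<open>auto simp: cells_left cells_right cells_top cells_bottom cell_mem simp del: One_nat_def\<close>)
qed

lemma zoom_exit_cell: "zoom n (exit_cell d n) (exit_point d) = exit_point d"
proof -
  have "2 * real (mid_row n) + 1 = 5 ^ n" "4 * real (spine_column n) + 3 = 3 * 5 ^ n"
    using arg_cong[OF mid_row[of n], of real] arg_cong[OF spine_column[of n], of real] by simp_all
  then show ?thesis by (cases d) (auto simp: zoom_def field_simps of_nat_diff)
qed

lemma limit_exit_exit_point: "limit_exit (\<lambda>_. 5) (\<lambda>_. the_pattern) d (exit_point d)"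
proof -
  have "(THE T. is_exit d (level_width (\<lambda>_. 5) n) (white_squares (\<lambda>_. the_pattern) n) T) =
      cell n (exit_cell d n)" if "n \<ge> 1" for n
    by (simp add: level_width_def white_squares_eq[OF that] is_exit_iff)
  then have "(\<Inter>n\<in>{1..}. THE T. is_exit d (level_width (\<lambda>_. 5) n) (white_squares (\<lambda>_. the_pattern) n) T) =
      (\<Inter>n\<in>{1..}. cell n (exit_cell d n))" by auto
  also have "\<dots> = {exit_point d}"
  proof (intro equalityI subsetI)
    fix p assume p: "p \<in> (\<Inter>n\<in>{1..}. cell n (exit_cell d n))"
    have unit: "exit_point d \<in> unit_square" by (cases d) (auto simp: unit_square_def)
    have "\<bar>fst p - fst (exit_point d)\<bar> \<le> (1/5) ^ n \<and> \<bar>snd p - snd (exit_point d)\<bar> \<le> (1/5) ^ n" for n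
    proof -
      have "p \<in> cell (Suc n) (exit_cell d (Suc n))" using p by auto
      then obtain z where z: "z \<in> unit_square" "p = zoom (Suc n) (exit_cell d (Suc n)) z"
        by (auto simp: cell_def)
      have "p - exit_point d = (1 / 5 ^ Suc n) *\<^sub>R (z - exit_point d)"
        by (subst zoom_exit_cell[of "Suc n", symmetric]) (simp only: z(2) zoom_diff)
      then have "\<bar>fst p - fst (exit_point d)\<bar> = (1/5) ^ Suc n * \<bar>fst z - fst (exit_point d)\<bar>"
        "\<bar>snd p - snd (exit_point d)\<bar> = (1/5) ^ Suc n * \<bar>snd z - snd (exit_point d)\<bar>"
        by (simp_all add: prod_eq_iff abs_mult power_one_over)
      moreover have "\<bar>fst z - fst (exit_point d)\<bar> \<le> 1" "\<bar>snd z - snd (exit_point d)\<bar> \<le> 1"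
        using z(1) unit by (auto simp: unit_square_def abs_le_iff)
      moreover have "(1/5) ^ Suc n * q \<le> (1/5) ^ n" if "q \<le> 1" for q :: real
        using mult_left_le[OF that, of "(1/5) ^ Suc n"] power_decreasing[of n "Suc n" "1/5 :: real"] by simp
      ultimately show ?thesis by (simp del: power_Suc)
    qed
    then have "p = exit_point d" by (intro prod_eqI eq_if_abs_diff_le_powers) auto
    then show "p \<in> {exit_point d}" by simp
  next
    fix p assume "p \<in> {exit_point d}"
    then have "p = zoom n (exit_cell d n) (exit_point d)" for n using zoom_exit_cell by simp
    moreover have "exit_point d \<in> unit_square" by (cases d) (auto simp: unit_square_def)
    ultimately show "p \<in> (\<Inter>n\<in>{1..}. cell n (exit_cell d n))"
      unfolding cell_def by (intro INT_I image_eqI)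
  qed
  finally show ?thesis unfolding limit_exit_def .
qed

lemma edge_box:
  fixes a b c d :: real
  assumes "a \<le> b" "c \<le> d"
  shows "edge Left ({a..b} \<times> {c..d}) = {a..a} \<times> {c..d}"
    and "edge Right ({a..b} \<times> {c..d}) = {b..b} \<times> {c..d}"
    and "edge Bottom ({a..b} \<times> {c..d}) = {a..b} \<times> {c..c}"
    and "edge Top ({a..b} \<times> {c..d}) = {a..b} \<times> {d..d}"
  using assms
  by (auto intro: antisym dest: bspec[where x = a] bspec[where x = b] bspec[where x = c] bspec[where x = d])

lemma unit_square_edge:
  "edge Left unit_square = {0} \<times> {0..1}" "edge Right unit_square = {1} \<times> {0..1}"
  "edge Bottom unit_square = {0..1} \<times> {0}" "edge Top unit_square = {0..1} \<times> {1}"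
  unfolding unit_square_def by (simp_all only: edge_box zero_le_one atLeastAtMost_singleton)

lemma edge_zoom: "edge d (zoom n v ` S) = zoom n v ` edge d S"
proof -
  have le: "fst (zoom n v z) \<le> fst (zoom n v z') \<longleftrightarrow> fst z \<le> fst z'"
    "snd (zoom n v z) \<le> snd (zoom n v z') \<longleftrightarrow> snd z \<le> snd z'" for z z'
    by (simp_all add: zoom_def divide_le_cancel)
  have *: "{p \<in> f ` S. \<forall>r\<in>f ` S. Q r p} = f ` {p \<in> S. \<forall>r\<in>S. Q (f r) (f p)}"
    for f :: "point \<Rightarrow> point" and Q by blast
  show ?thesis by (cases d) (simp_all only: edge.simps * le)
qed

text \<open>
  A point of the attractor on a side of the square may come from a neighbouring square. But there,
  too, it lies on the boundary of a copy, so that it is an exit of that copy; and all exits on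
  vertical sides lie at the same height relative to the rows, all those on horizontal sides at the
  same abscissa relative to the columns.
\<close>

lemma square_exit_cell:
  assumes v: "v \<in> cells n"
  shows "square_exit (\<lambda>_. the_pattern) (cell n v) d (zoom n v (exit_point d))"
  unfolding square_exit_def limit_set_eq_fractal cell_def edge_zoom
proof (intro equalityI subsetI)
  have "exit_point d \<in> edge d unit_square" by (cases d) (simp_all add: unit_square_edge del: edge.simps)
  then show "x \<in> fractal \<inter> zoom n v ` edge d unit_square" if "x \<in> {zoom n v (exit_point d)}" for x
    using zoom_fractal[OF v exit_point_fractal] that by blast
  fix x assume "x \<in> fractal \<inter> zoom n v ` edge d unit_square"
  then obtain y u z where y: "y \<in> edge d unit_square" "x = zoom n v y" and z: "z \<in> fractal" "x = zoom n u z"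
    using fractal_cells[of n] by blast
  have eq: "fst y - fst z = real (fst u) - real (fst v)" "snd y - snd z = real (snd u) - real (snd v)"
    using y(2) z(2) by (auto simp: zoom_def)
  have int: "a = b" if "a - b = real k - real l" "\<bar>a - b\<bar> < 1" for a b :: real and k l :: nat
  proof -
    have "\<bar>real k - real l\<bar> < 1" using that by simp
    then have "k = l" by linarith
    then show ?thesis using that by simp
  qed
  have ends: "b = 0 \<or> b = 1" if "a - b = real k - real l" "a = 0 \<or> a = 1" "0 \<le> b" "b \<le> 1" for a b :: real and k l :: nat
  proof -
    have "k = l \<or> k = Suc l \<or> l = Suc k" using that by linarith
    then show ?thesis using that by auto
  qed
  have "y = exit_point d"
  proof (cases "d \<in> {Left, Right}")
    case True
    then have fy: "fst y = fst (exit_point d)" "0 \<le> snd y" "snd y \<le> 1"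
      using y(1) by (auto simp: unit_square_edge simp del: edge.simps)
    have "fst z = 0 \<or> fst z = 1"
      using ends[OF eq(1)] fy(1) True fractal_bounds[OF z(1)] by fastforce
    then have "snd z = 1/2" using fractal_left[OF z(1)] fractal_right[OF z(1)] by auto
    then have "\<bar>snd y - snd z\<bar> < 1" using fy(2,3) by (simp add: abs_less_iff)
    then have "snd y = 1/2" using int[OF eq(2)] \<open>snd z = 1/2\<close> by simp
    then show ?thesis using fy(1) True by (auto simp: prod_eq_iff)
  next
    case False
    then have d: "d \<in> {Top, Bottom}" by (cases d) auto
    then have sy: "snd y = snd (exit_point d)" "0 \<le> fst y" "fst y \<le> 1"
      using y(1) by (auto simp: unit_square_edge simp del: edge.simps)
    have "snd z = 0 \<or> snd z = 1"
      using ends[OF eq(2)] sy(1) d fractal_bounds[OF z(1)] by fastforce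
    then have "fst z = 3/4" using fractal_bottom[OF z(1)] fractal_top[OF z(1)] by auto
    then have "\<bar>fst y - fst z\<bar> < 1" using sy(2,3) by (simp add: abs_less_iff)
    then have "fst y = 3/4" using int[OF eq(1)] \<open>fst z = 3/4\<close> by simp
    then show ?thesis using sy(1) d by (auto simp: prod_eq_iff)
  qed
  then show "x \<in> {zoom n v (exit_point d)}" using y(2) by simp
qed

text \<open>
  The sides are written with degenerate intervals so that two of them can be compared by
  \<open>times_eq_iff\<close> and \<open>Icc_eq_Icc\<close>.
\<close>

lemma cell_edge_box:
  "edge Left (cell 1 (i, j)) = {real i / 5 .. real i / 5} \<times> {real j / 5 .. (real j + 1) / 5}"
  "edge Right (cell 1 (i, j)) = {(real i + 1) / 5 .. (real i + 1) / 5} \<times> {real j / 5 .. (real j + 1) / 5}"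
  "edge Bottom (cell 1 (i, j)) = {real i / 5 .. (real i + 1) / 5} \<times> {real j / 5 .. real j / 5}"
  "edge Top (cell 1 (i, j)) = {real i / 5 .. (real i + 1) / 5} \<times> {(real j + 1) / 5 .. (real j + 1) / 5}"
proof -
  have "real i / 5 \<le> (real i + 1) / 5" "real j / 5 \<le> (real j + 1) / 5"
    by (simp_all add: divide_right_mono)
  then show "edge Left (cell 1 (i, j)) = {real i / 5 .. real i / 5} \<times> {real j / 5 .. (real j + 1) / 5}"
    "edge Right (cell 1 (i, j)) = {(real i + 1) / 5 .. (real i + 1) / 5} \<times> {real j / 5 .. (real j + 1) / 5}"
    "edge Bottom (cell 1 (i, j)) = {real i / 5 .. (real i + 1) / 5} \<times> {real j / 5 .. real j / 5}"
    "edge Top (cell 1 (i, j)) = {real i / 5 .. (real i + 1) / 5} \<times> {(real j + 1) / 5 .. (real j + 1) / 5}"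
    unfolding cell_box power_one_right by (simp_all only: edge_box)
qed

lemma common_side_cell:
  assumes "(i, j) \<noteq> (k, l)"
  shows "common_side (cell 1 (i, j)) (cell 1 (k, l)) \<longleftrightarrow>
    j = l \<and> (k = Suc i \<or> i = Suc k) \<or> i = k \<and> (l = Suc j \<or> j = Suc l)"
proof
  assume "common_side (cell 1 (i, j)) (cell 1 (k, l))"
  then obtain d e where "edge d (cell 1 (i, j)) = edge e (cell 1 (k, l))" by (auto simp: common_side_def)
  then show "j = l \<and> (k = Suc i \<or> i = Suc k) \<or> i = k \<and> (l = Suc j \<or> j = Suc l)"
    using assms by (cases d; cases e) (auto simp: cell_edge_box times_eq_iff Icc_eq_Icc simp del: edge.simps One_nat_def)
next
  assume "j = l \<and> (k = Suc i \<or> i = Suc k) \<or> i = k \<and> (l = Suc j \<or> j = Suc l)"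
  then consider "j = l" "k = Suc i" | "j = l" "i = Suc k" | "i = k" "l = Suc j" | "i = k" "j = Suc l" by blast
  then show "common_side (cell 1 (i, j)) (cell 1 (k, l))"
    unfolding common_side_def
  proof cases
    case 1
    then have "edge Right (cell 1 (i, j)) = edge Left (cell 1 (k, l))"
      by (simp only: cell_edge_box of_nat_Suc add.commute)
    then show "\<exists>d e. edge d (cell 1 (i, j)) = edge e (cell 1 (k, l))" by blast
  next
    case 2
    then have "edge Left (cell 1 (i, j)) = edge Right (cell 1 (k, l))"
      by (simp only: cell_edge_box of_nat_Suc add.commute)
    then show "\<exists>d e. edge d (cell 1 (i, j)) = edge e (cell 1 (k, l))" by blast
  next
    case 3
    then have "edge Top (cell 1 (i, j)) = edge Bottom (cell 1 (k, l))"
      by (simp only: cell_edge_box of_nat_Suc add.commute)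
    then show "\<exists>d e. edge d (cell 1 (i, j)) = edge e (cell 1 (k, l))" by blast
  next
    case 4
    then have "edge Bottom (cell 1 (i, j)) = edge Top (cell 1 (k, l))"
      by (simp only: cell_edge_box of_nat_Suc add.commute)
    then show "\<exists>d e. edge d (cell 1 (i, j)) = edge e (cell 1 (k, l))" by blast
  qed
qed

lemma pattern_graph_cell:
  assumes "(i, j) \<in> white" "(k, l) \<in> white"
  shows "{cell 1 (i, j), cell 1 (k, l)} \<in> pattern_graph the_pattern \<longleftrightarrow>
    j = l \<and> (k = Suc i \<or> i = Suc k) \<or> i = k \<and> (l = Suc j \<or> j = Suc l)"
proof -
  have sym: "common_side S T \<longleftrightarrow> common_side T S" for S T unfolding common_side_def by metis
  have "{cell 1 (i, j), cell 1 (k, l)} \<in> pattern_graph the_pattern \<longleftrightarrow>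
      (i, j) \<noteq> (k, l) \<and> common_side (cell 1 (i, j)) (cell 1 (k, l))"
    using assms sym unfolding pattern_graph_def the_pattern_def mem_Collect_eq doubleton_eq_iff
    by (metis cell_inj imageI)
  also have "\<dots> \<longleftrightarrow> j = l \<and> (k = Suc i \<or> i = Suc k) \<or> i = k \<and> (l = Suc j \<or> j = Suc l)"
    using common_side_cell by (metis n_not_Suc_n prod.inject)
  finally show ?thesis .
qed

text \<open>
  The distance to (3,3) in the grid, which is also the distance in the tree of white squares.
  Subtraction truncates, so \<open>(a - 3) + (3 - a)\<close> is \<open>\<bar>a - 3\<bar>\<close>.
\<close>

definition steps_to_root :: "nat \<times> nat \<Rightarrow> nat" where
  "steps_to_root v = (fst v - 3) + (3 - fst v) + (snd v - 3) + (3 - snd v)"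

lemma tree_the_pattern: "tree_graph the_pattern (pattern_graph the_pattern)"
proof (rule tree_graphI[where r = "cell 1 (3, 3)" and rank = "\<lambda>S. steps_to_root (inv_into UNIV (cell 1) S)"])
  have inv: "inv_into UNIV (cell 1) (cell 1 v) = v" for v
    by (rule inv_into_f_f) (auto intro: injI simp: cell_inj)
  show "cell 1 (3, 3) \<in> the_pattern" by (simp add: the_pattern_def white_def)
  show "\<exists>u\<in>the_pattern. {u, v} \<in> pattern_graph the_pattern \<and>
      steps_to_root (inv_into UNIV (cell 1) u) < steps_to_root (inv_into UNIV (cell 1) v)"
    if v: "v \<in> the_pattern" "v \<noteq> cell 1 (3, 3)" for v
  proof -
    obtain i j where ij: "(i, j) \<in> white" "v = cell 1 (i, j)" "(i, j) \<noteq> (3, 3)"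
      using v by (auto simp: the_pattern_def)
    have "\<exists>u\<in>white. (snd u = j \<and> (i = Suc (fst u) \<or> fst u = Suc i) \<or> fst u = i \<and> (j = Suc (snd u) \<or> snd u = Suc j)) \<and>
        steps_to_root u < steps_to_root (i, j)"
      using ij(1,3) unfolding white_def insert_iff empty_iff prod.inject
      by (elim disjE conjE; simp add: steps_to_root_def)
    then obtain k l where kl: "(k, l) \<in> white"
        "l = j \<and> (i = Suc k \<or> k = Suc i) \<or> k = i \<and> (j = Suc l \<or> l = Suc j)"
        "steps_to_root (k, l) < steps_to_root (i, j)" by force
    then have "{cell 1 (k, l), v} \<in> pattern_graph the_pattern"
      unfolding ij(2) pattern_graph_cell[OF kl(1) ij(1)] by blast
    then show ?thesis
      using kl(1,3) ij(2) by (intro bexI[of _ "cell 1 (k, l)"]) (auto simp: inv the_pattern_def simp del: One_nat_def)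
  qed
  show "u = u'"
    if in_pattern: "u \<in> the_pattern" "u' \<in> the_pattern" "v \<in> the_pattern"
      and edges: "{u, v} \<in> pattern_graph the_pattern" "{u', v} \<in> pattern_graph the_pattern"
      and rank: "steps_to_root (inv_into UNIV (cell 1) u) < steps_to_root (inv_into UNIV (cell 1) v)"
        "steps_to_root (inv_into UNIV (cell 1) u') < steps_to_root (inv_into UNIV (cell 1) v)" for u u' v
  proof -
    obtain i j k l a b where w: "(i, j) \<in> white" "(k, l) \<in> white" "(a, b) \<in> white"
      and eq: "u = cell 1 (i, j)" "u' = cell 1 (k, l)" "v = cell 1 (a, b)"
      using in_pattern by (auto simp: the_pattern_def simp del: One_nat_def)
    have adj: "j = b \<and> (a = Suc i \<or> i = Suc a) \<or> i = a \<and> (b = Suc j \<or> j = Suc b)"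
        "l = b \<and> (a = Suc k \<or> k = Suc a) \<or> k = a \<and> (b = Suc l \<or> l = Suc b)"
      using edges unfolding eq pattern_graph_cell[OF w(1,3)] pattern_graph_cell[OF w(2,3)] .
    have "steps_to_root (i, j) < steps_to_root (a, b)" "steps_to_root (k, l) < steps_to_root (a, b)"
      using rank unfolding eq inv .
    then have "(i, j) = (k, l)"
      using adj w(3)[unfolded white_def insert_iff empty_iff prod.inject]
      by (elim disjE conjE; use w(1,2) in \<open>simp add: steps_to_root_def white_def\<close>)
    then show ?thesis using eq by simp
  qed
  show "steps_to_root (inv_into UNIV (cell 1) u) \<noteq> steps_to_root (inv_into UNIV (cell 1) v)"
    if in_pattern: "u \<in> the_pattern" "v \<in> the_pattern" and edges: "{u, v} \<in> pattern_graph the_pattern" for u v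
  proof -
    obtain i j a b where w: "(i, j) \<in> white" "(a, b) \<in> white"
      and eq: "u = cell 1 (i, j)" "v = cell 1 (a, b)"
      using in_pattern by (auto simp: the_pattern_def simp del: One_nat_def)
    have adj: "j = b \<and> (a = Suc i \<or> i = Suc a) \<or> i = a \<and> (b = Suc j \<or> j = Suc b)"
      using edges unfolding eq pattern_graph_cell[OF w(1,2)] .
    then show ?thesis unfolding eq inv steps_to_root_def by auto
  qed
qed

lemma is_exit_the_pattern: "is_exit d 5 the_pattern S \<longleftrightarrow> S = cell 1 (exit_cell d 1)"
  using is_exit_iff[of d 1 S] unfolding the_pattern_def white_cells by simp

lemma grid_square_the_pattern: "grid_square i j 5 \<in> the_pattern \<longleftrightarrow> (i, j) \<in> white"
  using grid_square_eq_cell[of i j 1] by (auto simp: the_pattern_def cell_inj simp del: One_nat_def)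

lemma labyrinth_the_pattern: "labyrinth_pattern 5 the_pattern"
proof -
  have "the_pattern \<subseteq> grid 5"
  proof
    fix S assume "S \<in> the_pattern"
    then obtain i j where "(i, j) \<in> white" "S = cell 1 (i, j)"
      by (auto simp: the_pattern_def simp del: One_nat_def)
    then show "S \<in> grid 5"
      using grid_square_eq_cell[of i j 1] white_bound[of i j] unfolding grid_def by fastforce
  qed
  moreover have "the_pattern \<noteq> {}" by (simp add: the_pattern_def white_def)
  moreover have "\<exists>!S. is_exit d 5 the_pattern S" for d by (simp only: is_exit_the_pattern) simp
  ultimately show ?thesis
    unfolding labyrinth_pattern_def pattern_def
    using tree_the_pattern by (simp add: grid_square_the_pattern) (simp add: white_def)
qed

lemma horizontally_blocked_the_pattern: "horizontally_blocked 5 the_pattern"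
  unfolding horizontally_blocked_def
proof (intro exI conjI)
  show "grid_square 2 2 5 \<notin> the_pattern" unfolding grid_square_the_pattern by (simp add: white_def)
qed (simp_all add: grid_square_the_pattern, auto simp: white_def)

lemma not_vertically_blocked_the_pattern: "\<not> vertically_blocked 5 the_pattern"
proof
  assume "vertically_blocked 5 the_pattern"
  then obtain i j where i: "i < 5" "(i, 0) \<in> white" and j: "j < 5" "(i, j) \<notin> white"
    unfolding vertically_blocked_def is_exit.simps grid_square_the_pattern by blast
  have "i = 3" using i(2) by (auto simp: white_def)
  then show False using j by (auto simp: white_def)
qed

section \<open>The arcs between the exits of the squares\<close>

lemma the_arc_fractal:
  assumes "arc g" "path_image g \<subseteq> fractal"
  shows "the_arc fractal (pathstart g) (pathfinish g) (path_image g)"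
  by (rule the_arcI[OF _ assms]) (rule fractal_no_simple_closed_curve)

lemma the_arc_zoom:
  assumes "arc g" "path_image g \<subseteq> fractal" and v: "v \<in> cells n"
  shows "the_arc fractal (zoom n v (pathstart g)) (zoom n v (pathfinish g)) (zoom n v ` path_image g)"
    and "arc_length (zoom n v ` path_image g) = ennreal (1 / 5 ^ n) * arc_length (path_image g)"
proof -
  have arc: "arc (zoom n v \<circ> g)" by (rule arc_zoom(1)[OF assms])
  from the_arc_fractal[OF arc arc_zoom(2)[OF assms]]
  show "the_arc fractal (zoom n v (pathstart g)) (zoom n v (pathfinish g)) (zoom n v ` path_image g)"
    by (simp only: path_image_compose pathstart_compose pathfinish_compose)
  have "arc_length (path_image (zoom n v \<circ> g)) = curve_length (zoom n v \<circ> g)"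
    by (rule arc_length_path_image[OF arc])
  also have "\<dots> = ennreal (1 / 5 ^ n) * curve_length g"
    by (rule curve_length_scale) (simp_all add: dist_zoom)
  finally show "arc_length (zoom n v ` path_image g) = ennreal (1 / 5 ^ n) * arc_length (path_image g)"
    by (simp only: path_image_compose arc_length_path_image[OF assms(1)])
qed

lemma exit_distance_le_arc_length:
  assumes "arc g" "path_image g \<subseteq> fractal" "pathstart g = exit_point d" "pathfinish g = exit_point e"
  shows "exit_distance d e \<le> arc_length (path_image g)"
  unfolding arc_length_path_image[OF assms(1)] exit_distance_def inner_distance_def
  by (rule INF_lower) (simp add: arcs_between_def assms)

lemma infinite_arc:
  assumes "d \<noteq> e" "exit_distance d e = \<infinity> \<or> exit_distance e d = \<infinity>" "v \<in> cells n"
  shows "\<exists>C. the_arc fractal (zoom n v (exit_point d)) (zoom n v (exit_point e)) C \<and> arc_length C = \<infinity>"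
proof -
  obtain g where g: "arc g" "path_image g \<subseteq> fractal"
      "pathstart g = exit_point d" "pathfinish g = exit_point e"
    using arc_between_exits[OF assms(1)] .
  have "exit_distance d e \<le> arc_length (path_image g)"
    by (rule exit_distance_le_arc_length[OF g])
  moreover have "exit_distance e d \<le> arc_length (path_image g)"
    using exit_distance_le_arc_length[of "reversepath g" e d] g by (simp add: arc_reversepath)
  ultimately have "arc_length (path_image g) = \<infinity>"
    using assms(2) by (auto simp: top_unique)
  then have "arc_length (zoom n v ` path_image g) = \<infinity>"
    unfolding the_arc_zoom(2)[OF g(1,2) assms(3)] by (simp add: ennreal_mult_top)
  then show ?thesis using the_arc_zoom(1)[OF g(1,2) assms(3)] g(3,4) by auto
qed

lemma arc_length_closed_segment:
  fixes a b :: "'a::euclidean_space"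
  assumes "a \<noteq> b"
  shows "arc_length (closed_segment a b) = dist a b"
  using arc_length_path_image[OF arc_linepath[OF assms]] by (simp add: curve_length_linepath)

text \<open>
  The column of the attractor is a segment, and by uniqueness it is the only arc between its
  endpoints.
\<close>

lemma vertical_arc:
  assumes "v \<in> cells n"
  shows "the_arc fractal (zoom n v (exit_point Top)) (zoom n v (exit_point Bottom))
    (closed_segment (zoom n v (exit_point Top)) (zoom n v (exit_point Bottom)))"
proof -
  let ?g = "linepath (exit_point Top) (exit_point Bottom)"
  have "path_image ?g \<subseteq> fractal"
    unfolding fractal_def using joins_spine[of 1 0] by (auto simp: joins_def simp del: path_image_linepath)
  moreover have "arc ?g" by (simp add: arc_linepath)
  moreover have "zoom n v ` path_image ?g = path_image (linepath (zoom n v (exit_point Top)) (zoom n v (exit_point Bottom)))"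
  proof -
    have "zoom n v \<circ> ?g = linepath (zoom n v (exit_point Top)) (zoom n v (exit_point Bottom))"
      by (rule ext) (simp add: linepath_def zoom_def field_simps)
    then show ?thesis by (metis path_image_compose)
  qed
  ultimately show ?thesis using the_arc_zoom(1)[of ?g v n] assms by simp
qed

theorem proposition5:
  shows "\<exists>(m :: nat \<Rightarrow> nat) (A :: nat \<Rightarrow> point set set)
          (ex :: side \<Rightarrow> point) (sq_ex :: point set \<Rightarrow> side \<Rightarrow> point).
    (\<forall>k\<ge>1. labyrinth_pattern (m k) (A k) \<and>
            horizontally_blocked (m k) (A k) \<and> \<not> vertically_blocked (m k) (A k)) \<and>
    (\<forall>d. limit_exit m A d (ex d)) \<and>
    (\<forall>n\<ge>1. \<forall>W\<in>white_squares A n. \<forall>d. square_exit A W d (sq_ex W d)) \<and>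

    ((\<exists>C. the_arc (limit_set A) (ex Top) (ex Bottom) C \<and> arc_length C = 1) \<and>
     (\<forall>n\<ge>1. \<forall>W\<in>white_squares A n.
        \<exists>C. the_arc (limit_set A) (sq_ex W Top) (sq_ex W Bottom) C \<and>
            (\<exists>x y y'. y < y' \<and> C = closed_segment (x, y) (x, y')) \<and>
            arc_length C < \<infinity>) \<and>
     (\<forall>x y y'. y < y' \<and> closed_segment (x, y) (x, y') \<subseteq> limit_set A \<longrightarrow>
        arc_length (closed_segment (x, y) (x, y')) < \<infinity>)) \<and>

    ((\<exists>C. the_arc (limit_set A) (ex Left) (ex Right) C \<and> arc_length C = \<infinity>) \<and>
     (\<forall>n\<ge>1. \<forall>W\<in>white_squares A n.
        \<exists>C. the_arc (limit_set A) (sq_ex W Left) (sq_ex W Right) C \<and> arc_length C = \<infinity>)) \<and>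

    (\<forall>d1\<in>{Top, Bottom}. \<forall>d2\<in>{Left, Right}.
       (\<exists>C. the_arc (limit_set A) (ex d1) (ex d2) C \<and> arc_length C = \<infinity>) \<and>
       (\<forall>n\<ge>1. \<forall>W\<in>white_squares A n.
          \<exists>C. the_arc (limit_set A) (sq_ex W d1) (sq_ex W d2) C \<and> arc_length C = \<infinity>))"
proof -
  define sq_ex where "sq_ex W d = (THE p. square_exit (\<lambda>_. the_pattern) W d p)" for W d
  have sq_ex: "sq_ex (cell n v) d = zoom n v (exit_point d)" if "v \<in> cells n" for n v d
    unfolding sq_ex_def using square_exit_cell[OF that, of d]
    by (intro the_equality) (auto simp: square_exit_def)
  have on_squares: "\<forall>n\<ge>1. \<forall>W\<in>white_squares (\<lambda>_. the_pattern) n. P W"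
    if "\<And>n v. v \<in> cells n \<Longrightarrow> P (cell n v)" for P
    using that by (auto simp: white_squares_eq)
  have seg_finite: "arc_length (closed_segment (x, y) (x, y')) < \<infinity>" if "y < y'" for x y y' :: real
    using that by (subst arc_length_closed_segment) auto
  have infinite: "\<exists>C. the_arc fractal (sq_ex (cell n v) d) (sq_ex (cell n v) e) C \<and> arc_length C = \<infinity>"
    "\<exists>C. the_arc fractal (exit_point d) (exit_point e) C \<and> arc_length C = \<infinity>"
    if "d = Left \<and> e = Right \<or> d \<in> {Top, Bottom} \<and> e \<in> {Left, Right}" "v \<in> cells n" for d e v n
  proof -
    have "d \<noteq> e" using that(1) by auto
    moreover have "exit_distance d e = \<infinity> \<or> exit_distance e d = \<infinity>"
      using that(1) exit_distance_Left_Right_infinite exit_distance_infinite by auto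
    ultimately have *: "w \<in> cells k \<Longrightarrow> \<exists>C. the_arc fractal (zoom k w (exit_point d)) (zoom k w (exit_point e)) C \<and> arc_length C = \<infinity>"
      for k w by (rule infinite_arc)
    show "\<exists>C. the_arc fractal (sq_ex (cell n v) d) (sq_ex (cell n v) e) C \<and> arc_length C = \<infinity>"
      unfolding sq_ex[OF that(2)] by (rule *[OF that(2)])
    show "\<exists>C. the_arc fractal (exit_point d) (exit_point e) C \<and> arc_length C = \<infinity>"
      using *[of "(0, 0)" 0] by simp
  qed
  have vertical: "\<exists>C. the_arc fractal (sq_ex (cell n v) Top) (sq_ex (cell n v) Bottom) C \<and>
      (\<exists>x y y'. y < y' \<and> C = closed_segment (x, y) (x, y')) \<and> arc_length C < \<infinity>"
    if v: "v \<in> cells n" for n v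
  proof -
    obtain x y y' where xy: "zoom n v (exit_point Bottom) = (x, y)" "zoom n v (exit_point Top) = (x, y')" "y < y'"
      by (auto simp: zoom_def divide_strict_right_mono)
    then show ?thesis
      using vertical_arc[OF v] seg_finite[OF xy(3), of x] unfolding sq_ex[OF v] xy
      by (metis closed_segment_commute)
  qed
  have unit: "\<exists>C. the_arc fractal (exit_point Top) (exit_point Bottom) C \<and> arc_length C = 1"
  proof -
    have "dist (exit_point Top) (exit_point Bottom) = 1" by (simp add: dist_Pair_Pair)
    then have "arc_length (closed_segment (exit_point Top) (exit_point Bottom)) = 1"
      by (subst arc_length_closed_segment) auto
    then show ?thesis using vertical_arc[of "(0, 0)" 0] by auto
  qed
  show ?thesis
  proof (rule exI[of _ "\<lambda>_. 5"], rule exI[of _ "\<lambda>_. the_pattern"], rule exI[of _ exit_point],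
      rule exI[of _ sq_ex], unfold limit_set_eq_fractal, intro conjI)
    show "\<forall>k\<ge>1::nat. labyrinth_pattern 5 the_pattern \<and> horizontally_blocked 5 the_pattern \<and>
        \<not> vertically_blocked 5 the_pattern"
      using labyrinth_the_pattern horizontally_blocked_the_pattern not_vertically_blocked_the_pattern
      by blast
    show "\<forall>d. limit_exit (\<lambda>_. 5) (\<lambda>_. the_pattern) d (exit_point d)"
      by (rule allI) (rule limit_exit_exit_point)
    show "\<forall>n\<ge>1. \<forall>W\<in>white_squares (\<lambda>_. the_pattern) n. \<forall>d. square_exit (\<lambda>_. the_pattern) W d (sq_ex W d)"
      by (rule on_squares) (simp only: sq_ex square_exit_cell simp_thms)
    show "\<exists>C. the_arc fractal (exit_point Top) (exit_point Bottom) C \<and> arc_length C = 1"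
      by (rule unit)
    show "\<forall>n\<ge>1. \<forall>W\<in>white_squares (\<lambda>_. the_pattern) n.
        \<exists>C. the_arc fractal (sq_ex W Top) (sq_ex W Bottom) C \<and>
            (\<exists>x y y'. y < y' \<and> C = closed_segment (x, y) (x, y')) \<and> arc_length C < \<infinity>"
      by (rule on_squares) (rule vertical)
    show "\<forall>x y y'. y < y' \<and> closed_segment (x, y) (x, y') \<subseteq> fractal \<longrightarrow>
        arc_length (closed_segment (x, y) (x, y')) < \<infinity>"
      by (intro allI impI) (rule seg_finite, erule conjunct1)
    show "\<exists>C. the_arc fractal (exit_point Left) (exit_point Right) C \<and> arc_length C = \<infinity>"
      by (rule infinite(2)[of _ _ "(0, 0)" 0]) simp_all
    show "\<forall>n\<ge>1. \<forall>W\<in>white_squares (\<lambda>_. the_pattern) n.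
        \<exists>C. the_arc fractal (sq_ex W Left) (sq_ex W Right) C \<and> arc_length C = \<infinity>"
      by (rule on_squares) (rule infinite(1), simp_all)
    show "\<forall>d1\<in>{Top, Bottom}. \<forall>d2\<in>{Left, Right}.
       (\<exists>C. the_arc fractal (exit_point d1) (exit_point d2) C \<and> arc_length C = \<infinity>) \<and>
       (\<forall>n\<ge>1. \<forall>W\<in>white_squares (\<lambda>_. the_pattern) n.
          \<exists>C. the_arc fractal (sq_ex W d1) (sq_ex W d2) C \<and> arc_length C = \<infinity>)"
    proof (intro ballI conjI)
      fix d e assume de: "d \<in> {Top, Bottom}" "e \<in> {Left, Right}"
      show "\<exists>C. the_arc fractal (exit_point d) (exit_point e) C \<and> arc_length C = \<infinity>"
        by (rule infinite(2)[of _ _ "(0, 0)" 0]) (use de in simp_all)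
      show "\<forall>n\<ge>1. \<forall>W\<in>white_squares (\<lambda>_. the_pattern) n.
          \<exists>C. the_arc fractal (sq_ex W d) (sq_ex W e) C \<and> arc_length C = \<infinity>"
        by (rule on_squares) (rule infinite(1), use de in simp_all)
    qed
  qed
qed

end
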